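(* Let $B$ be a homology ball. (a) If $B$ is $k$-stacked then there is a $k$-stacked homology sphere $S$ such that $B$ is the antistar of a vertex in $S$. (b) If $B$ is $k$-shelled then there is a $k$-stellated sphere $S$ such that $B$ is the antistar of a vertex in $S$.
   Context: Simplicial complexes are finite and contain the empty set as a face. The antistar of a vertex $x$ in a complex $X$ is the subcomplex $\{\alpha\in X: x\notin\alpha\}$. For a finite set $\alpha$, $\overline{\alpha}$ is the complex of all subsets of $\alpha$, $\partial\alpha$ the complex of all proper subsets, and $\dim(\alpha)=\#(\alpha)-1$; $\ast$ denotes join. The standard ball $B^d_{d+1}$ is the face complex of a $d$-simplex; the standard sphere $S^d_{d+2}$ is the boundary complex of a $(d+1)$-simplex. A weak pseudomanifold is a pure $d$-dimensional complex in which each $(d-1)$-face lies in at most two facets; it is a pseudomanifold if its dual graph (facets as vertices, adjacent when meeting in a codimension-one face) is connected. Bistellar moves: let $X$ be $d$-dimensional and $\alpha,\beta$ disjoint non-empty finite sets with $\dim(\alpha)+\dim(\beta)=d$ such that the induced subcomplex of $X$ on $\alpha\sqcup\beta$ is $\overline{\alpha}\ast\partial\beta$ (if $\beta$ is a single vertex this means $\beta$ is a new vertex not in $X$). The complex $(X\setminus(\overline{\alpha}\ast\partial\beta))\cup(\partial\alpha\ast\overline{\beta})$ is obtained from $X$ by the bistellar move $\alpha\mapsto\beta$, of index $\dim(\beta)$. For $0\le k\le d+1$, a $d$-dimensional complex is a $k$-stellated sphere if it is obtained from $S^d_{d+2}$ by a finite (possibly empty) sequence of bistellar moves each of index $<k$.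 Shelling moves: for pure $d$-dimensional complexes $X,Y$, $X$ is obtained from $Y$ by the shelling move $\alpha\leadsto\beta$ if $\alpha$ and $\beta\ne\emptyset$ are disjoint faces of $X$ such that $Y\subseteq X$, $\alpha\sqcup\beta$ is the only facet of $X$ which is not a facet of $Y$, and the induced subcomplex of $Y$ on $\alpha\sqcup\beta$ is $\overline{\alpha}\ast\partial\beta$. Its index is $\dim(\beta)$. For $0\le k\le d$, a $d$-dimensional pseudomanifold is $k$-shelled if it is obtained from $B^d_{d+1}$ by a finite (possibly empty) sequence of shelling moves each of index $<k$. A homology sphere/ball means an $\mathbb{F}$-homology sphere/ball for some field $\mathbb{F}$. An $\mathbb{F}$-homology $d$-sphere is a $d$-dimensional complex in which the link of every face $\sigma$ (including $\emptyset$) has the reduced $\mathbb{F}$-homology of a $(d-\dim(\sigma)-1)$-sphere. An $\mathbb{F}$-homology $d$-ball is a $d$-dimensional $\mathbb{F}$-acyclic complex in which the link of every non-empty face $\sigma$ has the reduced homology of a $(d-\dim(\sigma)-1)$-sphere or of a point, and whose faces with acyclic link form an $\mathbb{F}$-homology $(d-1)$-sphere (its boundary). For $0\le k\le d$, a homology $d$-ball is $k$-stacked if all its faces of codimension at least $k+1$ (dimension $\le d-k-1$) lie in its boundary; a homology $d$-sphere is $k$-stacked if it is the boundary of a $k$-stacked homology $(d+1)$-ball. *)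

theory Defs
  imports Main "HOL-Library.Function_Algebras" "HOL-Library.Infinite_Typeclass"
begin

section \<open>Abstract simplicial complexes\<close>

definition complex :: "'v set set \<Rightarrow> bool" where
  "complex X \<longleftrightarrow> finite X \<and> {} \<in> X \<and> (\<forall>\<alpha>\<in>X. finite \<alpha> \<and> (\<forall>\<beta>. \<beta> \<subseteq> \<alpha> \<longrightarrow> \<beta> \<in> X))"

text \<open>Dimensions are integers, because the empty face has dimension \<open>-1\<close>.\<close>

definition face_dim :: "'v set \<Rightarrow> int" where
  "face_dim \<alpha> = int (card \<alpha>) - 1"

definition complex_dim :: "'v set set \<Rightarrow> int" where
  "complex_dim X = Max (face_dim ` X)"

definition facets :: "'v set set \<Rightarrow> 'v set set" where
  "facets X = {\<alpha> \<in> X. \<forall>\<beta>\<in>X. \<alpha> \<subseteq> \<beta> \<longrightarrow> \<beta> = \<alpha>}"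

definition pure_complex :: "int \<Rightarrow> 'v set set \<Rightarrow> bool" where
  "pure_complex d X \<longleftrightarrow> complex X \<and> complex_dim X = d \<and> (\<forall>\<alpha>\<in>facets X. face_dim \<alpha> = d)"

definition link :: "'v set set \<Rightarrow> 'v set \<Rightarrow> 'v set set" where
  "link X \<sigma> = {\<tau> \<in> X. \<tau> \<inter> \<sigma> = {} \<and> \<tau> \<union> \<sigma> \<in> X}"

definition antistar :: "'v \<Rightarrow> 'v set set \<Rightarrow> 'v set set" where
  "antistar x X = {\<alpha> \<in> X. x \<notin> \<alpha>}"

definition induced :: "'v set set \<Rightarrow> 'v set \<Rightarrow> 'v set set" where
  "induced X A = {\<alpha> \<in> X. \<alpha> \<subseteq> A}"

definition join :: "'v set set \<Rightarrow> 'v set set \<Rightarrow> 'v set set" where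
  "join X Y = {\<alpha> \<union> \<beta> | \<alpha> \<beta>. \<alpha> \<in> X \<and> \<beta> \<in> Y}"

abbreviation simplex_closure :: "'v set \<Rightarrow> 'v set set" where
  "simplex_closure \<alpha> \<equiv> Pow \<alpha>"

definition simplex_boundary :: "'v set \<Rightarrow> 'v set set" where
  "simplex_boundary \<alpha> = {\<beta>. \<beta> \<subset> \<alpha>}"

text \<open>Standard balls and spheres are determined up to isomorphism; here every choice of the
  vertex set is admitted.\<close>

definition standard_ball :: "int \<Rightarrow> 'v set set \<Rightarrow> bool" where
  "standard_ball d X \<longleftrightarrow> (\<exists>A. finite A \<and> face_dim A = d \<and> X = simplex_closure A)"

definition standard_sphere :: "int \<Rightarrow> 'v set set \<Rightarrow> bool" where
  "standard_sphere d X \<longleftrightarrow> (\<exists>A. finite A \<and> face_dim A = d + 1 \<and> X = simplex_boundary A)"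

definition weak_pseudomanifold :: "int \<Rightarrow> 'v set set \<Rightarrow> bool" where
  "weak_pseudomanifold d X \<longleftrightarrow> pure_complex d X \<and>
     (\<forall>\<rho>\<in>X. face_dim \<rho> = d - 1 \<longrightarrow> card {\<sigma> \<in> facets X. \<rho> \<subseteq> \<sigma>} \<le> 2)"

definition dual_adjacent :: "int \<Rightarrow> 'v set set \<Rightarrow> 'v set \<Rightarrow> 'v set \<Rightarrow> bool" where
  "dual_adjacent d X \<sigma> \<tau> \<longleftrightarrow> \<sigma> \<in> facets X \<and> \<tau> \<in> facets X \<and> face_dim (\<sigma> \<inter> \<tau>) = d - 1"

definition pseudomanifold :: "int \<Rightarrow> 'v set set \<Rightarrow> bool" where
  "pseudomanifold d X \<longleftrightarrow> weak_pseudomanifold d X \<and>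
     (\<forall>\<sigma>\<in>facets X. \<forall>\<tau>\<in>facets X. (dual_adjacent d X)\<^sup>*\<^sup>* \<sigma> \<tau>)"


section \<open>Bistellar moves and stellated spheres\<close>

text \<open>\<open>bistellar_move d \<alpha> \<beta> X Y\<close>: the move \<open>\<alpha> \<mapsto> \<beta>\<close> applies to \<open>X\<close> and produces \<open>Y\<close>. If \<open>\<beta>\<close> is a
  single vertex, the condition on the induced subcomplex says that this vertex is not in \<open>X\<close>.\<close>

definition bistellar_move ::
    "int \<Rightarrow> 'v set \<Rightarrow> 'v set \<Rightarrow> 'v set set \<Rightarrow> 'v set set \<Rightarrow> bool" where
  "bistellar_move d \<alpha> \<beta> X Y \<longleftrightarrow> complex X \<and> complex_dim X = d \<and>
     finite \<alpha> \<and> finite \<beta> \<and> \<alpha> \<noteq> {} \<and> \<beta> \<noteq> {} \<and> \<alpha> \<inter> \<beta> = {} \<and>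
     face_dim \<alpha> + face_dim \<beta> = d \<and>
     induced X (\<alpha> \<union> \<beta>) = join (simplex_closure \<alpha>) (simplex_boundary \<beta>) \<and>
     Y = (X - join (simplex_closure \<alpha>) (simplex_boundary \<beta>))
           \<union> join (simplex_boundary \<alpha>) (simplex_closure \<beta>)"

definition bistellar_step :: "int \<Rightarrow> nat \<Rightarrow> 'v set set \<Rightarrow> 'v set set \<Rightarrow> bool" where
  "bistellar_step d k X Y \<longleftrightarrow> (\<exists>\<alpha> \<beta>. bistellar_move d \<alpha> \<beta> X Y \<and> face_dim \<beta> < int k)"

definition stellated_sphere :: "int \<Rightarrow> nat \<Rightarrow> 'v set set \<Rightarrow> bool" where
  "stellated_sphere d k S \<longleftrightarrow> int k \<le> d + 1 \<and> complex S \<and> complex_dim S = d \<and>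
     (\<exists>S0. standard_sphere d S0 \<and> (bistellar_step d k)\<^sup>*\<^sup>* S0 S)"


section \<open>Shelling moves and shelled pseudomanifolds\<close>

text \<open>\<open>shelling_move d \<alpha> \<beta> Y X\<close>: \<open>X\<close> is obtained from \<open>Y\<close> by the shelling move \<open>\<alpha> \<leadsto> \<beta>\<close>.\<close>

definition shelling_move ::
    "int \<Rightarrow> 'v set \<Rightarrow> 'v set \<Rightarrow> 'v set set \<Rightarrow> 'v set set \<Rightarrow> bool" where
  "shelling_move d \<alpha> \<beta> Y X \<longleftrightarrow> pure_complex d X \<and> pure_complex d Y \<and>
     \<alpha> \<in> X \<and> \<beta> \<in> X \<and> \<beta> \<noteq> {} \<and> \<alpha> \<inter> \<beta> = {} \<and> Y \<subseteq> X \<and>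
     facets X - facets Y = {\<alpha> \<union> \<beta>} \<and>
     induced Y (\<alpha> \<union> \<beta>) = join (simplex_closure \<alpha>) (simplex_boundary \<beta>)"

definition shelling_step :: "int \<Rightarrow> nat \<Rightarrow> 'v set set \<Rightarrow> 'v set set \<Rightarrow> bool" where
  "shelling_step d k Y X \<longleftrightarrow> (\<exists>\<alpha> \<beta>. shelling_move d \<alpha> \<beta> Y X \<and> face_dim \<beta> < int k)"

definition shelled :: "int \<Rightarrow> nat \<Rightarrow> 'v set set \<Rightarrow> bool" where
  "shelled d k X \<longleftrightarrow> int k \<le> d \<and> pseudomanifold d X \<and>
     (\<exists>X0. standard_ball d X0 \<and> (shelling_step d k)\<^sup>*\<^sup>* X0 X)"


section \<open>Reduced simplicial homology with field coefficients\<close>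

text \<open>Oriented chains, without fixing an order of the vertices: an \<open>i\<close>-chain is an alternating
  function on the orderings (as distinct lists) of the \<open>i\<close>-dimensional faces. Its value on
  \<open>[v\<^sub>0, \<dots>, v\<^sub>i]\<close> is the coefficient of the oriented simplex \<open>[v\<^sub>0, \<dots>, v\<^sub>i]\<close>. The empty list
  orders the empty face, so the complex is augmented and its homology is reduced.\<close>

definition chains :: "'v set set \<Rightarrow> int \<Rightarrow> ('v list \<Rightarrow> 'f::field) set" where
  "chains X i = {c.
     (\<forall>vs. c vs \<noteq> 0 \<longrightarrow> distinct vs \<and> set vs \<in> X \<and> face_dim (set vs) = i) \<and>
     (\<forall>us v w ws. c (us @ w # v # ws) = - c (us @ v # w # ws))}"

text \<open>Since \<open>[vs]\<close> has coefficient \<open>1\<close> in the boundary of \<open>[v, vs]\<close>, the usual alternating sum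
  over the positions of the omitted vertex turns into the following sum of coefficients.\<close>

definition boundary_map :: "'v set set \<Rightarrow> ('v list \<Rightarrow> 'f) \<Rightarrow> ('v list \<Rightarrow> 'f::field)" where
  "boundary_map X c = (\<lambda>vs. \<Sum>v\<in>\<Union>X. c (v # vs))"

definition cycles :: "'v set set \<Rightarrow> int \<Rightarrow> ('v list \<Rightarrow> 'f::field) set" where
  "cycles X i = {c \<in> chains X i. boundary_map X c = 0}"

definition boundaries :: "'v set set \<Rightarrow> int \<Rightarrow> ('v list \<Rightarrow> 'f::field) set" where
  "boundaries X i = boundary_map X ` chains X (i + 1)"

definition homology_class ::
    "'v set set \<Rightarrow> int \<Rightarrow> ('v list \<Rightarrow> 'f::field) \<Rightarrow> ('v list \<Rightarrow> 'f) set" where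
  "homology_class X i z = {z' \<in> cycles X i. z' - z \<in> boundaries X i}"

definition reduced_homology :: "'v set set \<Rightarrow> int \<Rightarrow> ('v list \<Rightarrow> 'f::field) set set" where
  "reduced_homology X i = homology_class X i ` cycles X i"

definition homology_vanishes :: "'f::field itself \<Rightarrow> 'v set set \<Rightarrow> int \<Rightarrow> bool" where
  "homology_vanishes F X i \<longleftrightarrow>
     (reduced_homology X i :: ('v list \<Rightarrow> 'f) set set) = {homology_class X i 0}"

text \<open>There is a linear isomorphism from the homology space in degree \<open>i\<close> onto the field.\<close>

definition homology_is_field :: "'f::field itself \<Rightarrow> 'v set set \<Rightarrow> int \<Rightarrow> bool" where
  "homology_is_field F X i \<longleftrightarrow>
     (\<exists>\<phi> :: ('v list \<Rightarrow> 'f) set \<Rightarrow> 'f.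
        bij_betw \<phi> (reduced_homology X i) UNIV \<and>
        (\<forall>z\<in>cycles X i. \<forall>z'\<in>cycles X i.
           \<phi> (homology_class X i (z + z')) =
             \<phi> (homology_class X i z) + \<phi> (homology_class X i z')) \<and>
        (\<forall>a. \<forall>z\<in>cycles X i.
           \<phi> (homology_class X i (\<lambda>vs. a * z vs)) = a * \<phi> (homology_class X i z)))"

definition homology_acyclic :: "'f::field itself \<Rightarrow> 'v set set \<Rightarrow> bool" where
  "homology_acyclic F X \<longleftrightarrow> (\<forall>i. homology_vanishes F X i)"

definition has_sphere_homology :: "'f::field itself \<Rightarrow> int \<Rightarrow> 'v set set \<Rightarrow> bool" where
  "has_sphere_homology F m X \<longleftrightarrow>
     homology_is_field F X m \<and> (\<forall>i. i \<noteq> m \<longrightarrow> homology_vanishes F X i)"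


section \<open>Homology spheres and balls\<close>

definition homology_sphere :: "'f::field itself \<Rightarrow> int \<Rightarrow> 'v set set \<Rightarrow> bool" where
  "homology_sphere F d X \<longleftrightarrow> complex X \<and> complex_dim X = d \<and>
     (\<forall>\<sigma>\<in>X. has_sphere_homology F (d - face_dim \<sigma> - 1) (link X \<sigma>))"

definition ball_boundary :: "'f::field itself \<Rightarrow> 'v set set \<Rightarrow> 'v set set" where
  "ball_boundary F B = {\<sigma> \<in> B. homology_acyclic F (link B \<sigma>)}"

definition homology_ball :: "'f::field itself \<Rightarrow> int \<Rightarrow> 'v set set \<Rightarrow> bool" where
  "homology_ball F d B \<longleftrightarrow> complex B \<and> complex_dim B = d \<and> homology_acyclic F B \<and>
     (\<forall>\<sigma>\<in>B. \<sigma> \<noteq> {} \<longrightarrow>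
        has_sphere_homology F (d - face_dim \<sigma> - 1) (link B \<sigma>) \<or>
        homology_acyclic F (link B \<sigma>)) \<and>
     homology_sphere F (d - 1) (ball_boundary F B)"

definition stacked_ball :: "'f::field itself \<Rightarrow> int \<Rightarrow> nat \<Rightarrow> 'v set set \<Rightarrow> bool" where
  "stacked_ball F d k B \<longleftrightarrow> int k \<le> d \<and> homology_ball F d B \<and>
     (\<forall>\<alpha>\<in>B. face_dim \<alpha> \<le> d - int k - 1 \<longrightarrow> \<alpha> \<in> ball_boundary F B)"

definition stacked_sphere :: "'f::field itself \<Rightarrow> int \<Rightarrow> nat \<Rightarrow> 'v set set \<Rightarrow> bool" where
  "stacked_sphere F d k S \<longleftrightarrow> homology_sphere F d S \<and>
     (\<exists>B. stacked_ball F (d + 1) k B \<and> S = ball_boundary F B)"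

end

theory Submission
  imports Defs
begin

text \<open>Cone off the boundary of \<open>B\<close> with a new vertex \<open>x\<close>: \<open>S = B \<union> x \<ast> \<partial>B\<close>.

  (a) The cone \<open>x \<ast> B\<close> is a homology ball with boundary \<open>S\<close>. If \<open>L\<close> is acyclic, taking the
  coefficients at \<open>x\<close> identifies the homology of \<open>L \<union> x \<ast> K\<close> with that of \<open>K\<close>, shifted by one;
  applied to links this shows that \<open>S\<close> is a homology sphere. The faces of \<open>x \<ast> B\<close> outside \<open>S\<close> are
  the \<open>x \<union> \<tau>\<close> with \<open>\<tau>\<close> interior in \<open>B\<close>, so stackedness is inherited.

  (b) A shelling move \<open>\<alpha> \<leadsto> \<beta>\<close> from \<open>Y\<close> to \<open>Y'\<close> becomes the bistellar move \<open>x \<union> \<alpha> \<mapsto> \<beta>\<close> between the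
  coned-off complexes; here \<open>\<partial>Y\<close> is generated by the ridges in a single facet, and \<open>\<alpha> \<noteq> {}\<close>
  because \<open>k \<le> d\<close>. The point is that every boundary ridge of \<open>Y\<close> containing \<open>\<alpha>\<close> lies in
  \<open>\<alpha> \<union> \<beta>\<close>. The boundary of \<open>\<beta>\<close> is a cycle modulo two in the link of \<open>\<alpha>\<close> in \<open>Y\<close>, and it bounds there
  because links in shellable complexes are shellable. So the link of \<open>\<alpha>\<close> in \<open>Y'\<close> carries a nonzero
  top-dimensional cycle modulo two, which by strong connectivity contains all facets of the link.
  Hence the link of \<open>\<alpha>\<close> in \<open>Y'\<close> has no boundary.\<close>

section \<open>Coning off a subcomplex\<close>

text \<open>For a subcomplex \<open>K\<close> of \<open>L\<close> this glues a cone over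
  \<open>K\<close> onto \<open>L\<close>; the face \<open>{}\<close> of \<open>K\<close> contributes
  the apex. Taking \<open>K\<close> to be the boundary of \<open>L\<close> gives the sphere, and
  \<open>K = L\<close> the full cone.\<close>

definition cone_off :: "'v \<Rightarrow> 'v set set \<Rightarrow> 'v set set \<Rightarrow> 'v set set" where
  "cone_off x L K = L \<union> insert x ` K"

text \<open>With a fresh apex, the presence of \<open>x\<close> alone decides in which of the two
  pieces a face lies. Later arguments split on it.\<close>

lemma mem_cone_off:
  assumes "x \<notin> \<Union>L" and "K \<subseteq> L"
  shows "\<gamma> \<in> cone_off x L K \<longleftrightarrow> (if x \<in> \<gamma> then \<gamma> - {x} \<in> K else \<gamma> \<in> L)"
proof (cases "x \<in> \<gamma>")
  case True
  have "\<gamma> \<in> insert x ` K \<longleftrightarrow> \<gamma> - {x} \<in> K"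
  proof
    assume "\<gamma> \<in> insert x ` K"
    then obtain \<kappa> where "\<kappa> \<in> K" "\<gamma> = insert x \<kappa>" by blast
    moreover from this have "x \<notin> \<kappa>" using assms by blast
    ultimately show "\<gamma> - {x} \<in> K" by simp
  next
    assume "\<gamma> - {x} \<in> K"
    then have "insert x (\<gamma> - {x}) \<in> insert x ` K" by (rule imageI)
    then show "\<gamma> \<in> insert x ` K" using True by (simp add: insert_absorb)
  qed
  then show ?thesis using True assms by (auto simp: cone_off_def)
next
  case False
  then show ?thesis by (auto simp: cone_off_def)
qed

lemma complex_cone_off:
  assumes "complex L" "complex K" "K \<subseteq> L"
  shows "complex (cone_off x L K)"
proof -
  have K: "\<beta> \<in> cone_off x L K" if "\<alpha> \<in> K" "\<beta> \<subseteq> insert x \<alpha>" for \<alpha> \<beta>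
  proof (cases "x \<in> \<beta>")
    case True
    have "\<beta> - {x} \<in> K" using that assms(2) unfolding complex_def by blast
    then show ?thesis using True
      by (auto simp: cone_off_def image_iff insert_absorb intro!: bexI[of _ "\<beta> - {x}"])
  next
    case False
    then have "\<beta> \<in> K" using that assms(2) unfolding complex_def by blast
    then show ?thesis using assms(3) by (auto simp: cone_off_def)
  qed
  have L: "\<beta> \<in> cone_off x L K" if "\<alpha> \<in> L" "\<beta> \<subseteq> \<alpha>" for \<alpha> \<beta>
    using that assms(1) unfolding complex_def cone_off_def by blast
  have "finite \<alpha> \<and> (\<forall>\<beta>\<subseteq>\<alpha>. \<beta> \<in> cone_off x L K)" if \<alpha>: "\<alpha> \<in> cone_off x L K" for \<alpha>
  proof -
    from \<alpha> consider "\<alpha> \<in> L" | \<kappa> where "\<kappa> \<in> K" "\<alpha> = insert x \<kappa>" unfolding cone_off_def by blast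
    then show ?thesis
      by cases (use K L assms(1,2) in \<open>auto simp: complex_def\<close>)
  qed
  moreover have "finite (cone_off x L K)" "{} \<in> cone_off x L K"
    using assms(1,2) by (auto simp: complex_def cone_off_def)
  ultimately show ?thesis unfolding complex_def by blast
qed

lemma antistar_cone_off:
  assumes "x \<notin> \<Union>L"
  shows "antistar x (cone_off x L K) = L"
  using assms by (auto simp: antistar_def cone_off_def)

lemma complex_dim_eqI:
  assumes "finite X" "\<sigma> \<in> X" "face_dim \<sigma> = d" "\<And>\<tau>. \<tau> \<in> X \<Longrightarrow> face_dim \<tau> \<le> d"
  shows "complex_dim X = d"
  unfolding complex_dim_def using assms by (intro Max_eqI) auto

lemma face_dim_le_complex_dim:
  assumes "complex X" "\<sigma> \<in> X"
  shows "face_dim \<sigma> \<le> complex_dim X"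
  using assms by (auto simp: complex_def complex_dim_def)

lemma exists_face_of_dim:
  assumes "complex X" "complex_dim X = d"
  obtains \<sigma> where "\<sigma> \<in> X" "face_dim \<sigma> = d"
proof -
  have "finite (face_dim ` X)" "face_dim ` X \<noteq> {}" using assms(1) by (auto simp: complex_def)
  from Max_in[OF this] show thesis using that assms(2) by (auto simp: complex_dim_def)
qed

lemma finite_vertices: "complex X \<Longrightarrow> finite (\<Union>X)"
  by (auto simp: complex_def)

section \<open>Homology of coned-off complexes\<close>

lemma chainsD:
  assumes "c \<in> chains X i"
  shows "c vs \<noteq> 0 \<Longrightarrow> distinct vs" "c vs \<noteq> 0 \<Longrightarrow> set vs \<in> X" "c vs \<noteq> 0 \<Longrightarrow> face_dim (set vs) = i"
    and "c (us @ w # v # ws) = - c (us @ v # w # ws)"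
  using assms unfolding chains_def by blast+

lemma chains_swap2: "c \<in> chains X i \<Longrightarrow> c (w # v # ws) = - c (v # w # ws)"
  using chainsD(4)[of c X i "[]" w v ws] by simp

lemma chainsI:
  assumes "\<And>vs. c vs \<noteq> 0 \<Longrightarrow> distinct vs \<and> set vs \<in> X \<and> face_dim (set vs) = i"
    and "\<And>us v w ws. c (us @ w # v # ws) = - c (us @ v # w # ws)"
  shows "c \<in> chains X i"
  using assms unfolding chains_def by blast

lemma chains_add:
  assumes "c \<in> chains X i" "c' \<in> chains X i"
  shows "c + c' \<in> chains X i"
proof (rule chainsI)
  fix vs assume "(c + c') vs \<noteq> 0"
  then have "c vs \<noteq> 0 \<or> c' vs \<noteq> 0" by (auto simp: plus_fun_def)
  then show "distinct vs \<and> set vs \<in> X \<and> face_dim (set vs) = i"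
    using chainsD(1-3)[OF assms(1)] chainsD(1-3)[OF assms(2)] by blast
next
  fix us v w ws
  show "(c + c') (us @ w # v # ws) = - (c + c') (us @ v # w # ws)"
    using chainsD(4)[OF assms(1), of us w v ws] chainsD(4)[OF assms(2), of us w v ws]
    by (simp add: plus_fun_def)
qed

lemma chains_scale:
  assumes c: "c \<in> chains X i"
  shows "(\<lambda>vs. a * c vs) \<in> chains X i"
proof (rule chainsI)
  fix us v w ws
  show "a * c (us @ w # v # ws) = - (a * c (us @ v # w # ws))"
    by (simp add: chainsD(4)[OF c, of us w v ws])
qed (use chainsD(1-3)[OF c] in auto)

lemma chains_uminus: "c \<in> chains X i \<Longrightarrow> - c \<in> chains X i"
  using chains_scale[of c X i "- 1"] by (simp add: fun_Compl_def)

lemma chains_zero: "0 \<in> chains X i"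
  by (simp add: chains_def zero_fun_def)

lemma chains_diff: "c \<in> chains X i \<Longrightarrow> c' \<in> chains X i \<Longrightarrow> c - c' \<in> chains X i"
  using chains_add[of c X i "- c'"] chains_uminus[of c' X i] by simp

lemma chains_mono: "X \<subseteq> Y \<Longrightarrow> chains X i \<subseteq> chains Y i"
  unfolding chains_def by blast

lemma boundary_add: "boundary_map X (c + c') = boundary_map X c + boundary_map X c'"
  by (simp add: boundary_map_def plus_fun_def sum.distrib)

lemma boundary_uminus: "boundary_map X (- c) = - boundary_map X c"
  by (simp add: boundary_map_def fun_Compl_def sum_negf)

lemma boundary_diff: "boundary_map X (c - c') = boundary_map X c - boundary_map X c'"
  using boundary_add[of X c "- c'"] by (simp add: boundary_uminus)

lemma boundary_scale: "boundary_map X (\<lambda>vs. a * c vs) = (\<lambda>vs. a * boundary_map X c vs)"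
  by (simp add: boundary_map_def sum_distrib_left)

lemma boundary_zero: "boundary_map X 0 = 0"
  by (simp add: boundary_map_def zero_fun_def)

text \<open>The larger sum only gains zero terms, because a chain of \<open>X\<close> vanishes on
  lists with a vertex outside \<open>X\<close>. Boundaries of chains of subcomplexes can therefore
  all be taken in the big complex.\<close>

lemma boundary_map_mono:
  assumes "complex Y" "X \<subseteq> Y" "c \<in> chains X i"
  shows "boundary_map Y c = boundary_map X c"
proof
  fix vs
  have "c (v # vs) = 0" if "v \<notin> \<Union>X" for v
    using chainsD(2)[OF assms(3), of "v # vs"] that by fastforce
  then show "boundary_map Y c vs = boundary_map X c vs"
    unfolding boundary_map_def
    by (intro sum.mono_neutral_right) (use assms finite_vertices[of Y] in auto)
qed

lemma boundary_chains:
  assumes X: "complex X" and c: "c \<in> chains X i"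
  shows "boundary_map X c \<in> chains X (i - 1)"
proof -
  have "distinct vs \<and> set vs \<in> X \<and> face_dim (set vs) = i - 1" if nz: "boundary_map X c vs \<noteq> 0" for vs
  proof -
    obtain v where v: "c (v # vs) \<noteq> 0"
      using nz unfolding boundary_map_def by (rule sum.not_neutral_contains_not_neutral)
    note * = chainsD(1-3)[OF c v]
    have "set vs \<subseteq> set (v # vs)" by auto
    then have "set vs \<in> X" using X *(2) unfolding complex_def by blast
    then show ?thesis using * by (simp add: face_dim_def)
  qed
  moreover have "boundary_map X c (us @ w # v # ws) = - boundary_map X c (us @ v # w # ws)" for us v w ws
    unfolding boundary_map_def sum_negf[symmetric]
    by (intro sum.cong refl) (rule chainsD(4)[OF c, of "_ # us", unfolded append_Cons])
  ultimately show ?thesis unfolding chains_def by blast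
qed

text \<open>The diagonal has to be assumed to vanish because of characteristic two.\<close>

lemma alternating_double_sum:
  fixes g :: "'a \<Rightarrow> 'a \<Rightarrow> 'b::ab_group_add"
  assumes "finite A" "\<And>v. g v v = 0" "\<And>v w. g v w = - g w v"
  shows "(\<Sum>v\<in>A. \<Sum>w\<in>A. g v w) = 0"
  using assms(1)
proof (induction A rule: finite_induct)
  case (insert a A)
  have "(\<Sum>v\<in>A. g v a) = - (\<Sum>w\<in>A. g a w)"
    unfolding sum_negf[symmetric] by (intro sum.cong refl assms(3))
  then show ?case using insert assms(2) by (simp add: sum.distrib)
qed simp

text \<open>The two omitted vertices are the two leading entries, so this is a double sum of an
  alternating function. Its diagonal vanishes since chains live on distinct lists.\<close>

lemma boundary_boundary:
  assumes X: "complex X" and c: "c \<in> chains X i"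
  shows "boundary_map X (boundary_map X c) = 0"
proof
  fix vs
  have "(\<Sum>v\<in>\<Union>X. \<Sum>w\<in>\<Union>X. c (w # v # vs)) = 0"
  proof (rule alternating_double_sum)
    show "c (v # v # vs) = 0" for v using chainsD(1)[OF c, of "v # v # vs"] by auto
    show "c (w # v # vs) = - c (v # w # vs)" for v w by (rule chains_swap2[OF c])
  qed (rule finite_vertices[OF X])
  then show "boundary_map X (boundary_map X c) vs = 0 vs" by (simp add: boundary_map_def)
qed

lemma cycles_add: "z \<in> cycles X i \<Longrightarrow> z' \<in> cycles X i \<Longrightarrow> z + z' \<in> cycles X i"
  by (simp add: cycles_def chains_add boundary_add)

lemma cycles_diff: "z \<in> cycles X i \<Longrightarrow> z' \<in> cycles X i \<Longrightarrow> z - z' \<in> cycles X i"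
  by (simp add: cycles_def chains_diff boundary_diff)

lemma cycles_scale: "z \<in> cycles X i \<Longrightarrow> (\<lambda>vs. a * z vs) \<in> cycles X i"
  by (simp add: cycles_def chains_scale boundary_scale) (simp add: zero_fun_def)

lemma cycles_zero: "0 \<in> cycles X i"
  by (simp add: cycles_def chains_zero boundary_zero)

lemma boundaries_diff: "z \<in> boundaries X i \<Longrightarrow> z' \<in> boundaries X i \<Longrightarrow> z - z' \<in> boundaries X i"
  unfolding boundaries_def by (auto simp: boundary_diff[symmetric] intro!: imageI chains_diff)

lemma boundaries_zero: "0 \<in> boundaries X i"
  unfolding boundaries_def by (rule image_eqI[of _ _ 0]) (simp_all add: boundary_zero chains_zero)

lemma homology_class_eq_iff:
  assumes "z \<in> cycles X i" "z' \<in> cycles X i"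
  shows "homology_class X i z = homology_class X i z' \<longleftrightarrow> z - z' \<in> boundaries X i"
proof
  assume "homology_class X i z = homology_class X i z'"
  moreover have "z \<in> homology_class X i z" using assms(1) boundaries_zero by (simp add: homology_class_def)
  ultimately show "z - z' \<in> boundaries X i" by (simp add: homology_class_def)
next
  assume d: "z - z' \<in> boundaries X i"
  have "y - z \<in> boundaries X i \<longleftrightarrow> y - z' \<in> boundaries X i" for y
  proof
    assume "y - z \<in> boundaries X i"
    from boundaries_diff[OF this boundaries_diff[OF boundaries_zero d]]
    show "y - z' \<in> boundaries X i" by (simp add: algebra_simps)
  next
    assume "y - z' \<in> boundaries X i"
    from boundaries_diff[OF this d] show "y - z \<in> boundaries X i" by (simp add: algebra_simps)
  qed
  then show "homology_class X i z = homology_class X i z'" by (simp add: homology_class_def)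
qed

text \<open>Allows vanishing to be checked on cycles, without passing to classes.\<close>

lemma homology_vanishes_iff:
  fixes F :: "'f::field itself"
  shows "homology_vanishes F X i \<longleftrightarrow> (cycles X i :: ('v list \<Rightarrow> 'f) set) \<subseteq> boundaries X i"
proof -
  have img: "h ` A = {h a} \<longleftrightarrow> (\<forall>z\<in>A. h z = h a)" if "a \<in> A" for h :: "'a \<Rightarrow> 'b" and a A
    using that by auto
  have "homology_vanishes F X i \<longleftrightarrow>
      (\<forall>z \<in> (cycles X i :: ('v list \<Rightarrow> 'f) set). homology_class X i z = homology_class X i 0)"
    unfolding homology_vanishes_def reduced_homology_def by (rule img[OF cycles_zero])
  also have "\<dots> \<longleftrightarrow> (\<forall>z \<in> (cycles X i :: ('v list \<Rightarrow> 'f) set). z \<in> boundaries X i)"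
    using homology_class_eq_iff[OF _ cycles_zero] by (intro ball_cong refl) simp
  finally show ?thesis by (simp only: subset_iff Ball_def)
qed

text \<open>Pulls the isomorphism back to a functional on cycles. Such a functional can be composed
  with a map between cycle spaces, which is how homology is transported below; \<open>z0\<close>
  records surjectivity.\<close>

lemma homology_is_fieldE:
  fixes F :: "'f::field itself" and X :: "'v set set"
  assumes "homology_is_field F X i"
  obtains f :: "('v list \<Rightarrow> 'f) \<Rightarrow> 'f" and z0 where
    "\<And>z z'. z \<in> cycles X i \<Longrightarrow> z' \<in> cycles X i \<Longrightarrow> f (z + z') = f z + f z'"
    "\<And>a z. z \<in> cycles X i \<Longrightarrow> f (\<lambda>vs. a * z vs) = a * f z"
    "\<And>z. z \<in> cycles X i \<Longrightarrow> f z = 0 \<longleftrightarrow> z \<in> boundaries X i"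
    "z0 \<in> cycles X i" "f z0 \<noteq> 0"
proof -
  obtain \<phi> :: "('v list \<Rightarrow> 'f) set \<Rightarrow> 'f" where
    bij: "bij_betw \<phi> (reduced_homology X i) UNIV"
    and add: "\<And>z z'. z \<in> cycles X i \<Longrightarrow> z' \<in> cycles X i \<Longrightarrow>
       \<phi> (homology_class X i (z + z')) = \<phi> (homology_class X i z) + \<phi> (homology_class X i z')"
    and scale: "\<And>a z. z \<in> cycles X i \<Longrightarrow>
       \<phi> (homology_class X i (\<lambda>vs. a * z vs)) = a * \<phi> (homology_class X i z)"
    using assms unfolding homology_is_field_def by blast
  have zero: "\<phi> (homology_class X i 0) = 0"
    using add[OF cycles_zero cycles_zero] by (simp only: add_0_left add_cancel_right_right)
  have ker: "\<phi> (homology_class X i z) = 0 \<longleftrightarrow> z \<in> boundaries X i" if z: "z \<in> cycles X i" for z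
  proof -
    have "\<phi> (homology_class X i z) = \<phi> (homology_class X i 0) \<longleftrightarrow>
        homology_class X i z = homology_class X i 0"
      using bij z cycles_zero unfolding bij_betw_def reduced_homology_def
      by (intro inj_on_eq_iff) auto
    then show ?thesis using homology_class_eq_iff[OF z cycles_zero] zero by simp
  qed
  have "1 \<in> \<phi> ` homology_class X i ` cycles X i"
    using bij unfolding bij_betw_def reduced_homology_def by simp
  then obtain z0 where "z0 \<in> cycles X i" "\<phi> (homology_class X i z0) = 1" by (auto simp: image_iff)
  then show thesis by (intro that[of "\<lambda>z. \<phi> (homology_class X i z)" z0] add scale ker) simp_all
qed

text \<open>The functional descends to classes; the kernel condition makes it injective there, and
  one nonzero value makes it onto the field.\<close>

lemma homology_is_fieldI:
  fixes F :: "'f::field itself" and X :: "'v set set" and f :: "('v list \<Rightarrow> 'f) \<Rightarrow> 'f"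
  assumes add: "\<And>z z'. z \<in> cycles X i \<Longrightarrow> z' \<in> cycles X i \<Longrightarrow> f (z + z') = f z + f z'"
    and scale: "\<And>a z. z \<in> cycles X i \<Longrightarrow> f (\<lambda>vs. a * z vs) = a * f z"
    and ker: "\<And>z. z \<in> cycles X i \<Longrightarrow> f z = 0 \<longleftrightarrow> z \<in> boundaries X i"
    and z0: "z0 \<in> cycles X i" "f z0 \<noteq> 0"
  shows "homology_is_field F X i"
proof -
  have eq: "f z = f z' \<longleftrightarrow> homology_class X i z = homology_class X i z'"
    if z: "z \<in> cycles X i" "z' \<in> cycles X i" for z z'
  proof -
    have "f z = f (z - z') + f z'" using add[OF cycles_diff[OF z] z(2)] by simp
    then show ?thesis using ker[OF cycles_diff[OF z]] homology_class_eq_iff[OF z] by auto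
  qed
  \<comment> \<open>Evaluates at a chosen representative; by \<open>eq\<close> the choice does not
    matter.\<close>
  define \<phi> where "\<phi> = (\<lambda>C. f (SOME z. z \<in> cycles X i \<and> homology_class X i z = C))"
  have \<phi>: "\<phi> (homology_class X i z) = f z" if z: "z \<in> cycles X i" for z
  proof -
    have "\<exists>y. y \<in> cycles X i \<and> homology_class X i y = homology_class X i z" using z by blast
    from someI_ex[OF this] show ?thesis unfolding \<phi>_def using eq z by blast
  qed
  have "bij_betw \<phi> (reduced_homology X i) UNIV"
    unfolding bij_betw_def
  proof (intro conjI UNIV_eq_I[symmetric])
    show "inj_on \<phi> (reduced_homology X i)"
      unfolding reduced_homology_def by (rule inj_onI) (use \<phi> eq in auto)
    fix a
    \<comment> \<open>The multiple of \<open>z0\<close> on which \<open>f\<close> takes the value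
      \<open>a\<close>.\<close>
    let ?z = "\<lambda>vs. (a / f z0) * z0 vs"
    have "a = \<phi> (homology_class X i ?z)"
      by (subst \<phi>[OF cycles_scale[OF z0(1)]], subst scale[OF z0(1)]) (simp add: z0(2))
    then show "a \<in> \<phi> ` reduced_homology X i"
      unfolding reduced_homology_def by (rule image_eqI) (rule imageI, rule cycles_scale[OF z0(1)])
  qed
  then show ?thesis
    unfolding homology_is_field_def
    by (intro exI[of _ \<phi>]) (simp add: \<phi> add scale cycles_add cycles_scale)
qed

section \<open>Coefficients at the apex and cones over chains\<close>

definition slice :: "'v \<Rightarrow> ('v list \<Rightarrow> 'f) \<Rightarrow> 'v list \<Rightarrow> 'f" where
  "slice x c = (\<lambda>vs. c (x # vs))"

text \<open>The sign is that of moving the first \<open>x\<close> to the front. Hence lists that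
  start with \<open>x\<close> get the coefficient of \<open>b\<close> unchanged, and slicing undoes
  coning.\<close>

definition cone_chain :: "'v \<Rightarrow> ('v list \<Rightarrow> 'f::field) \<Rightarrow> 'v list \<Rightarrow> 'f" where
  "cone_chain x b = (\<lambda>vs. if x \<in> set vs
     then (-1) ^ length (takeWhile (\<lambda>v. v \<noteq> x) vs) * b (remove1 x vs) else 0)"

lemma slice_add: "slice x (c + c') = slice x c + slice x c'"
  by (simp add: slice_def plus_fun_def)

lemma slice_diff: "slice x (c - c') = slice x c - slice x c'"
  by (simp add: slice_def fun_diff_def)

lemma slice_scale: "slice x (\<lambda>vs. a * c vs) = (\<lambda>vs. a * slice x c vs)"
  by (simp add: slice_def)

lemma slice_cone_chain: "slice x (cone_chain x b) = b"
  by (simp add: slice_def cone_chain_def)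

lemma cone_chain_split:
  assumes "x \<notin> set us"
  shows "cone_chain x b (us @ x # ws) = (-1) ^ length us * b (us @ ws)"
  using assms by (simp add: cone_chain_def takeWhile_append remove1_append)

locale coned_off =
  fixes x :: 'v and L K :: "'v set set"
  assumes complex_L: "complex L" and complex_K: "complex K" and K_sub_L: "K \<subseteq> L"
    and fresh: "x \<notin> \<Union>L"
begin

abbreviation "S \<equiv> cone_off x L K"

lemma complex_S: "complex S"
  using complex_cone_off complex_L complex_K K_sub_L .

lemma L_sub_S: "L \<subseteq> S"
  by (simp add: cone_off_def)

lemma fresh_K: "b \<in> chains K i \<Longrightarrow> x \<in> set vs \<Longrightarrow> b vs = 0"
  using chainsD(2)[of b K i vs] fresh K_sub_L by blast

lemma slice_chains:
  assumes c: "c \<in> chains S i"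
  shows "slice x c \<in> chains K (i - 1)"
proof -
  have "distinct vs \<and> set vs \<in> K \<and> face_dim (set vs) = i - 1" if "slice x c vs \<noteq> 0" for vs
  proof -
    have "c (x # vs) \<noteq> 0" using that by (simp add: slice_def)
    note * = chainsD(1-3)[OF c this]
    then have "insert x (set vs) - {x} \<in> K"
      using mem_cone_off[OF fresh K_sub_L, of "set (x # vs)"] by simp
    then show ?thesis using * by (simp add: face_dim_def)
  qed
  moreover have "slice x c (us @ w # v # ws) = - slice x c (us @ v # w # ws)" for us v w ws
    using chainsD(4)[OF c, of "x # us" w v ws] by (simp add: slice_def)
  ultimately show ?thesis unfolding chains_def by blast
qed

text \<open>The minus sign comes from exchanging \<open>x\<close> with the summation vertex. Up to
  sign, slicing is a chain map of degree -1 from \<open>S\<close> to \<open>K\<close>.\<close>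

lemma slice_boundary:
  assumes c: "c \<in> chains S i"
  shows "slice x (boundary_map S c) = - boundary_map K (slice x c)"
proof -
  have "slice x (boundary_map S c) = - boundary_map S (slice x c)"
    by (simp add: slice_def boundary_map_def fun_Compl_def chains_swap2[OF c, of x] flip: sum_negf)
  moreover have "boundary_map S (slice x c) = boundary_map K (slice x c)"
    using boundary_map_mono[OF complex_S _ slice_chains[OF c]] K_sub_L L_sub_S by blast
  ultimately show ?thesis by simp
qed

text \<open>Transpositions carry any occurrence of \<open>x\<close> to the front, so a vanishing
  slice forces the chain to live on faces without \<open>x\<close>, which are faces of
  \<open>L\<close>.\<close>

lemma slice_eq_0:
  assumes c: "c \<in> chains S i" and "slice x c = 0"
  shows "c \<in> chains L i"
proof -
  have "c (us @ x # ws) = 0" for us ws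
  proof (induction us arbitrary: ws rule: rev_induct)
    case Nil
    then show ?case using assms(2) by (simp add: slice_def fun_eq_iff)
  next
    case (snoc u us)
    then show ?case using chainsD(4)[OF c, of us u x ws] by simp
  qed
  then have "x \<notin> set vs" if "c vs \<noteq> 0" for vs using that by (metis split_list)
  then have "set vs \<in> L" if "c vs \<noteq> 0" for vs
    using chainsD(2)[OF c that] mem_cone_off[OF fresh K_sub_L, of "set vs"] that by simp
  then show ?thesis using chainsD[OF c] by (intro chainsI) blast+
qed

lemma slice_chains_L: "c \<in> chains L i \<Longrightarrow> slice x c = 0"
  using chainsD(2)[of c L i "x # _"] fresh by (fastforce simp: slice_def fun_eq_iff)

text \<open>For alternation only the position of \<open>x\<close> matters. If \<open>x\<close> is
  one of the two swapped entries, the sign flips while the list without \<open>x\<close> stays the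
  same; otherwise the sign is unchanged and \<open>b\<close> alternates.\<close>

lemma cone_chain_chains:
  assumes b: "b \<in> chains K (i - 1)"
  shows "cone_chain x b \<in> chains S i"
proof -
  have "distinct vs \<and> set vs \<in> S \<and> face_dim (set vs) = i" if nz: "cone_chain x b vs \<noteq> 0" for vs
  proof -
    have "x \<in> set vs" using nz by (auto simp: cone_chain_def split: if_splits)
    then obtain us ws where vs: "vs = us @ x # ws" "x \<notin> set us" by (metis split_list_first)
    then have nb: "b (us @ ws) \<noteq> 0" using nz cone_chain_split[of x us b ws] by auto
    note * = chainsD(1-3)[OF b nb]
    have "x \<notin> set (us @ ws)" using fresh_K[OF b, of "us @ ws"] nb by blast
    moreover have "set vs = insert x (set (us @ ws))" using vs by simp
    ultimately show ?thesis using * vs by (auto simp: face_dim_def cone_off_def)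
  qed
  moreover have "cone_chain x b (us @ w # v # ws) = - cone_chain x b (us @ v # w # ws)" for us v w ws
  proof (cases "x \<in> set us")
    case True
    then show ?thesis
      using chainsD(4)[OF b, of "remove1 x us" w v ws]
      by (simp add: cone_chain_def remove1_append)
  next
    case us: False
    show ?thesis
    proof (cases "w = x \<or> v = x")
      case True
      then consider "w = x" "v = x" | "w = x" "v \<noteq> x" | "w \<noteq> x" "v = x" by blast
      then show ?thesis
      proof cases
        case 1
        then show ?thesis
          using fresh_K[OF b, of "us @ x # ws"] us cone_chain_split[OF us, of b "x # ws"] by simp
      next
        case 2
        then show ?thesis
          using cone_chain_split[OF us, of b "v # ws"] cone_chain_split[of x "us @ [v]" b ws] us by simp
      next
        case 3
        then show ?thesis
          using cone_chain_split[OF us, of b "w # ws"] cone_chain_split[of x "us @ [w]" b ws] us by simp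
      qed
    next
      case vw: False
      show ?thesis
      proof (cases "x \<in> set ws")
        case True
        then obtain ws1 ws2 where ws: "ws = ws1 @ x # ws2" "x \<notin> set ws1" by (metis split_list_first)
        moreover have "x \<noteq> w" "x \<noteq> v" using vw by auto
        ultimately show ?thesis
          using us chainsD(4)[OF b, of us w v "ws1 @ ws2"]
            cone_chain_split[of x "us @ w # v # ws1" b ws2] cone_chain_split[of x "us @ v # w # ws1" b ws2]
          by simp
      next
        case False
        then show ?thesis using us vw by (auto simp: cone_chain_def)
      qed
    qed
  qed
  ultimately show ?thesis unfolding chains_def by blast
qed

lemma slice_cycles:
  assumes "z \<in> cycles S i"
  shows "slice x z \<in> cycles K (i - 1)"
proof -
  have "slice x (boundary_map S z) = 0" using assms by (simp add: cycles_def slice_def zero_fun_def)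
  then show ?thesis using assms slice_chains slice_boundary[of z i] by (auto simp: cycles_def)
qed

section \<open>The homology shift for acyclic \<open>L\<close>\<close>

context
  fixes F :: "'f::field itself"
  assumes acyclic: "homology_acyclic F L"
begin

lemma acyclicD:
  fixes z :: "'v list \<Rightarrow> 'f"
  assumes "z \<in> chains L i" "boundary_map S z = 0"
  obtains l where "l \<in> chains S (i + 1)" "boundary_map S l = z" "slice x l = 0"
proof -
  have "z \<in> cycles L i"
    using assms boundary_map_mono[OF complex_S L_sub_S assms(1)] by (simp add: cycles_def)
  then have "z \<in> boundaries L i"
    using acyclic unfolding homology_acyclic_def homology_vanishes_iff by blast
  then obtain l where l: "l \<in> chains L (i + 1)" "z = boundary_map L l" by (auto simp: boundaries_def)
  then show thesis
    using that[of l] chains_mono[OF L_sub_S] boundary_map_mono[OF complex_S L_sub_S l(1)]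
      slice_chains_L by blast
qed

text \<open>Slicing is well defined and injective on homology. If the slice of \<open>z\<close> is
  the boundary of \<open>b\<close>, adding the boundary of the cone over \<open>b\<close> cancels
  all coefficients at \<open>x\<close>; what is left is a cycle of \<open>L\<close>, which bounds by
  acyclicity.\<close>

lemma boundaries_slice_iff:
  fixes z :: "'v list \<Rightarrow> 'f"
  assumes z: "z \<in> cycles S i"
  shows "z \<in> boundaries S i \<longleftrightarrow> slice x z \<in> boundaries K (i - 1)"
proof
  assume "z \<in> boundaries S i"
  then obtain c where c: "c \<in> chains S (i + 1)" "z = boundary_map S c" by (auto simp: boundaries_def)
  have "slice x z = boundary_map K (- slice x c)"
    using slice_boundary[OF c(1)] c(2) by (simp add: boundary_uminus)
  then show "slice x z \<in> boundaries K (i - 1)"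
    using slice_chains[OF c(1)] chains_uminus by (auto simp: boundaries_def)
next
  assume "slice x z \<in> boundaries K (i - 1)"
  then obtain b where b: "b \<in> chains K i" "slice x z = boundary_map K b" by (auto simp: boundaries_def)
  let ?e = "cone_chain x b"
  have e: "?e \<in> chains S (i + 1)" using cone_chain_chains[of b "i + 1"] b(1) by simp
  let ?w = "z + boundary_map S ?e"
  have zc: "z \<in> chains S i" "boundary_map S z = 0" using z by (auto simp: cycles_def)
  have "boundary_map S ?e \<in> chains S i" using boundary_chains[OF complex_S e] by simp
  then have w: "?w \<in> chains S i" using zc chains_add by blast
  have "slice x ?w = 0"
    using slice_boundary[OF e] b(2) by (simp add: slice_add slice_cone_chain)
  then have "?w \<in> chains L i" using slice_eq_0[OF w] by blast
  moreover have "boundary_map S ?w = 0"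
    using zc boundary_boundary[OF complex_S e] by (simp add: boundary_add)
  ultimately obtain l where l: "l \<in> chains S (i + 1)" "boundary_map S l = ?w" by (rule acyclicD)
  have "z = boundary_map S (l - ?e)" using l(2) by (simp add: boundary_diff)
  then show "z \<in> boundaries S i" using chains_diff[OF l(1) e] by (auto simp: boundaries_def)
qed

text \<open>The cone over \<open>y\<close> has slice \<open>y\<close> but need not be a cycle. Since
  \<open>y\<close> is a cycle, the boundary of the cone lies in \<open>L\<close> and is filled there
  by some \<open>l\<close>; subtracting \<open>l\<close> gives a cycle and does not change the
  slice.\<close>

lemma slice_cycles_surj:
  fixes y :: "'v list \<Rightarrow> 'f"
  assumes y: "y \<in> cycles K (i - 1)"
  obtains z where "z \<in> cycles S i" "slice x z = y"
proof -
  let ?e = "cone_chain x y"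
  have yc: "y \<in> chains K (i - 1)" "boundary_map K y = 0" using y by (auto simp: cycles_def)
  have e: "?e \<in> chains S i" by (rule cone_chain_chains[OF yc(1)])
  have d: "boundary_map S ?e \<in> chains S (i - 1)" using boundary_chains[OF complex_S e] .
  have "slice x (boundary_map S ?e) = 0"
    using slice_boundary[OF e] yc(2) by (simp add: slice_cone_chain)
  then have "boundary_map S ?e \<in> chains L (i - 1)" using slice_eq_0[OF d] by blast
  then obtain l where l: "l \<in> chains S (i - 1 + 1)" "boundary_map S l = boundary_map S ?e" "slice x l = 0"
    using boundary_boundary[OF complex_S e] by (rule acyclicD)
  have "?e - l \<in> cycles S i"
    using l(1,2) e chains_diff[of ?e S i l] by (simp add: cycles_def boundary_diff)
  moreover have "slice x (?e - l) = y" using l(3) by (simp add: slice_diff slice_cone_chain)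
  ultimately show thesis by (rule that)
qed

text \<open>The functional for \<open>K\<close>, composed with slicing, is one for \<open>S\<close>
  in the next degree.\<close>

lemma sphere_homology_cone_off:
  assumes "has_sphere_homology F m K"
  shows "has_sphere_homology F (m + 1) S"
  unfolding has_sphere_homology_def
proof (intro conjI allI impI)
  from assms have "homology_is_field F K m" by (simp add: has_sphere_homology_def)
  then obtain f :: "('v list \<Rightarrow> 'f) \<Rightarrow> 'f" and y where
    add: "\<And>z z'. z \<in> cycles K m \<Longrightarrow> z' \<in> cycles K m \<Longrightarrow> f (z + z') = f z + f z'"
    and scale: "\<And>a z. z \<in> cycles K m \<Longrightarrow> f (\<lambda>vs. a * z vs) = a * f z"
    and ker: "\<And>z. z \<in> cycles K m \<Longrightarrow> f z = 0 \<longleftrightarrow> z \<in> boundaries K m"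
    and y: "y \<in> cycles K m" "f y \<noteq> 0"
    by (rule homology_is_fieldE) (rule that)
  have sl: "slice x z \<in> cycles K m" if "z \<in> cycles S (m + 1)" for z :: "'v list \<Rightarrow> 'f"
    using slice_cycles[OF that] by simp
  have "y \<in> cycles K (m + 1 - 1)" using y(1) by simp
  then obtain z where z: "z \<in> cycles S (m + 1)" "slice x z = y" by (rule slice_cycles_surj)
  show "homology_is_field F S (m + 1)"
  proof (rule homology_is_fieldI)
    show "f (slice x (z + z')) = f (slice x z) + f (slice x z')"
      if "z \<in> cycles S (m + 1)" "z' \<in> cycles S (m + 1)" for z z'
      using add[OF sl[OF that(1)] sl[OF that(2)]] by (simp add: slice_add)
    show "f (slice x (\<lambda>vs. a * z vs)) = a * f (slice x z)" if "z \<in> cycles S (m + 1)" for a z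
      using scale[OF sl[OF that]] by (simp add: slice_scale)
    show "f (slice x z) = 0 \<longleftrightarrow> z \<in> boundaries S (m + 1)" if "z \<in> cycles S (m + 1)" for z
      using ker[OF sl[OF that]] boundaries_slice_iff[OF that] by simp
  qed (use z y in auto)
next
  fix i assume "i \<noteq> m + 1"
  then have "homology_vanishes F K (i - 1)" using assms by (simp add: has_sphere_homology_def)
  then show "homology_vanishes F S i"
    unfolding homology_vanishes_iff using boundaries_slice_iff slice_cycles by blast
qed

end

end

text \<open>A cycle \<open>z\<close> is the boundary of the cone over its part \<open>z0\<close>
  away from \<open>x\<close>. At \<open>x\<close> this is the cycle condition. Away from
  \<open>x\<close>, the boundary of the cone only receives the coefficient with \<open>x\<close> in
  front, which is that of \<open>z\<close>.\<close>

lemma acyclic_cone: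
  fixes F :: "'f::field itself" and x :: 'v
  assumes L: "complex L" "x \<notin> \<Union>L"
  shows "homology_acyclic F (cone_off x L L)"
proof -
  interpret coned_off x L L by unfold_locales (use L in auto)
  have "z \<in> boundaries S i" if z: "z \<in> cycles S i" for z :: "'v list \<Rightarrow> 'f" and i
  proof -
    have zc: "z \<in> chains S i" "boundary_map S z = 0" using z by (auto simp: cycles_def)
    define z0 where "z0 = (\<lambda>vs. if x \<in> set vs then 0 else z vs)"
    have z0: "z0 \<in> chains L i"
    proof (rule chainsI)
      fix vs assume "z0 vs \<noteq> 0"
      then have "x \<notin> set vs" "z vs \<noteq> 0" by (auto simp: z0_def split: if_splits)
      then show "distinct vs \<and> set vs \<in> L \<and> face_dim (set vs) = i"
        using chainsD(1-3)[OF zc(1), of vs] mem_cone_off[OF L(2) subset_refl, of "set vs"] by simp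
    next
      fix us v w ws
      show "z0 (us @ w # v # ws) = - z0 (us @ v # w # ws)"
        using chainsD(4)[OF zc(1), of us w v ws] by (auto simp: z0_def)
    qed
    let ?e = "cone_chain x z0"
    have e: "?e \<in> chains S (i + 1)" using cone_chain_chains[of z0 "i + 1"] z0 by simp
    let ?w = "z - boundary_map S ?e"
    have "boundary_map S ?e \<in> chains S i" using boundary_chains[OF complex_S e] by simp
    then have w: "?w \<in> chains S i" using zc chains_diff by blast
    have xS: "x \<in> \<Union>S" using complex_L by (auto simp: cone_off_def complex_def)
    have fS: "finite (\<Union>S)" using finite_vertices[OF complex_S] .
    have "slice x ?w = slice x z + boundary_map L z0"
      using slice_boundary[OF e] by (simp add: slice_diff slice_cone_chain)
    also have "boundary_map L z0 = boundary_map S z0"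
      using boundary_map_mono[OF complex_S L_sub_S z0] by simp
    also have "slice x z + boundary_map S z0 = 0"
    proof
      fix vs
      show "(slice x z + boundary_map S z0) vs = 0 vs"
      proof (cases "x \<in> set vs")
        case True
        then have "z (x # vs) = 0" using chainsD(1)[OF zc(1), of "x # vs"] by auto
        then show ?thesis using True by (simp add: slice_def boundary_map_def z0_def)
      next
        case False
        have "(\<Sum>v\<in>\<Union>S. z0 (v # vs)) = (\<Sum>v\<in>\<Union>S - {x}. z0 (v # vs))"
          using sum.remove[OF fS xS, of "\<lambda>v. z0 (v # vs)"] by (simp add: z0_def)
        also have "\<dots> = (\<Sum>v\<in>\<Union>S - {x}. z (v # vs))"
          using False by (intro sum.cong) (auto simp: z0_def)
        finally have "(slice x z + boundary_map S z0) vs = boundary_map S z vs"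
          using sum.remove[OF fS xS, of "\<lambda>v. z (v # vs)"] by (simp add: slice_def boundary_map_def)
        then show ?thesis using zc(2) by simp
      qed
    qed
    finally have wL: "?w \<in> chains L i" using slice_eq_0[OF w] by blast
    have "?w vs = 0" for vs
    proof (cases "x \<in> set vs")
      case True
      then show ?thesis using fresh_K[OF wL] by blast
    next
      case False
      then have "?e (v # vs) = 0" if "v \<noteq> x" for v using that by (simp add: cone_chain_def)
      then have "boundary_map S ?e vs = ?e (x # vs)"
        using sum.remove[OF fS xS, of "\<lambda>v. ?e (v # vs)"] by (simp add: boundary_map_def)
      also have "\<dots> = z vs" using False by (simp add: cone_chain_def z0_def)
      finally show ?thesis by simp
    qed
    then have "z = boundary_map S ?e" by (auto simp: fun_eq_iff)
    then show ?thesis using e by (auto simp: boundaries_def)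
  qed
  then show ?thesis unfolding homology_acyclic_def homology_vanishes_iff by blast
qed

section \<open>Links and dimension of coned-off complexes\<close>

lemma complex_link:
  assumes "complex X" "\<sigma> \<in> X"
  shows "complex (link X \<sigma>)"
proof -
  have "\<delta> \<in> link X \<sigma>" if "\<gamma> \<in> link X \<sigma>" "\<delta> \<subseteq> \<gamma>" for \<gamma> \<delta>
  proof -
    have "\<delta> \<union> \<sigma> \<subseteq> \<gamma> \<union> \<sigma>" "\<delta> \<inter> \<sigma> = {}" using that by (auto simp: link_def)
    then show ?thesis using that assms(1) unfolding link_def complex_def by blast
  qed
  moreover have "finite (link X \<sigma>)" "{} \<in> link X \<sigma>" "\<And>\<gamma>. \<gamma> \<in> link X \<sigma> \<Longrightarrow> finite \<gamma>"
    using assms by (simp_all add: complex_def link_def)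
  ultimately show ?thesis unfolding complex_def by blast
qed

context coned_off
begin

text \<open>Also covers faces outside \<open>K\<close>: their link in \<open>K\<close> is the empty
  family, because \<open>K\<close> is closed under subsets, so nothing is coned off.\<close>

lemma link_cone_off:
  assumes "\<sigma> \<in> L"
  shows "link S \<sigma> = cone_off x (link L \<sigma>) (link K \<sigma>)"
proof (rule set_eqI)
  fix \<gamma>
  have x: "x \<notin> \<sigma>" using assms fresh by blast
  have fl: "x \<notin> \<Union>(link L \<sigma>)" "link K \<sigma> \<subseteq> link L \<sigma>" using fresh K_sub_L by (auto simp: link_def)
  have eqs: "\<gamma> \<union> \<sigma> - {x} = (\<gamma> - {x}) \<union> \<sigma>" "(\<gamma> - {x}) \<inter> \<sigma> = \<gamma> \<inter> \<sigma>" using x by blast+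
  show "\<gamma> \<in> link S \<sigma> \<longleftrightarrow> \<gamma> \<in> cone_off x (link L \<sigma>) (link K \<sigma>)"
    unfolding mem_cone_off[OF fl]
    by (cases "x \<in> \<gamma>") (simp_all add: mem_cone_off[OF fresh K_sub_L] link_def x eqs del: Un_Diff)
qed

lemma link_cone_off_apex:
  assumes "\<tau> \<in> K"
  shows "link S (insert x \<tau>) = link K \<tau>"
proof (rule set_eqI)
  fix \<gamma>
  have x: "x \<notin> \<tau>" using assms fresh K_sub_L by blast
  show "\<gamma> \<in> link S (insert x \<tau>) \<longleftrightarrow> \<gamma> \<in> link K \<tau>"
  proof (cases "x \<in> \<gamma>")
    case True
    then show ?thesis using fresh K_sub_L by (auto simp: link_def)
  next
    case False
    then have "\<gamma> \<union> insert x \<tau> - {x} = \<gamma> \<union> \<tau>" using x by blast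
    moreover have "\<gamma> \<union> \<tau> \<in> K \<Longrightarrow> \<gamma> \<in> K" using complex_K by (auto simp: complex_def)
    ultimately show ?thesis
      using False mem_cone_off[OF fresh K_sub_L] K_sub_L by (auto simp: link_def)
  qed
qed

lemma dim_cone_off:
  assumes "complex_dim L \<le> d" "complex_dim K \<le> d - 1" "\<sigma> \<in> S" "face_dim \<sigma> = d"
  shows "complex_dim S = d"
proof (rule complex_dim_eqI)
  show "finite S" using complex_S by (simp add: complex_def)
  fix \<tau> assume "\<tau> \<in> S"
  then consider "\<tau> \<in> L" | \<gamma> where "\<tau> = insert x \<gamma>" "\<gamma> \<in> K" by (auto simp: cone_off_def)
  then show "face_dim \<tau> \<le> d"
  proof cases
    case 1
    then show ?thesis using face_dim_le_complex_dim[OF complex_L] assms(1) by force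
  next
    case 2
    have "card \<tau> \<le> Suc (card \<gamma>)" unfolding 2(1) by (rule card_insert_le_m1) auto
    then have "face_dim \<tau> \<le> face_dim \<gamma> + 1" by (simp add: face_dim_def)
    then show ?thesis using face_dim_le_complex_dim[OF complex_K 2(2)] assms(2) by linarith
  qed
qed (use assms in auto)

end

section \<open>Coning off the boundary of a homology ball: part (a)\<close>

locale fresh_ball =
  fixes F :: "'f::field itself" and d :: int and B :: "'v set set" and x :: 'v
  assumes ball: "homology_ball F d B" and fresh_B: "x \<notin> \<Union>B"
begin

abbreviation "K \<equiv> ball_boundary F B"

lemma complex_B: "complex B" and dim_B: "complex_dim B = d" and acyclic_B: "homology_acyclic F B"
  and sphere_K: "homology_sphere F (d - 1) K"
  and link_B: "\<sigma> \<in> B \<Longrightarrow> \<sigma> \<noteq> {} \<Longrightarrow>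
    has_sphere_homology F (d - face_dim \<sigma> - 1) (link B \<sigma>) \<or> homology_acyclic F (link B \<sigma>)"
  using ball by (auto simp: homology_ball_def)

lemma complex_K: "complex K" and dim_K: "complex_dim K = d - 1"
  using sphere_K by (auto simp: homology_sphere_def)

lemma empty_K: "{} \<in> K"
  using complex_K by (simp add: complex_def)

lemma K_sub_B: "K \<subseteq> B"
  by (auto simp: ball_boundary_def)

sublocale S: coned_off x B K
  by unfold_locales (use complex_B complex_K K_sub_B fresh_B in auto)

sublocale C: coned_off x B B
  by unfold_locales (use complex_B fresh_B in auto)

text \<open>A face of \<open>B\<close> has a cone as its link, hence an acyclic one. A face
  \<open>insert x \<tau>\<close> has the link of \<tau> in \<open>B\<close>, which is acyclic
  exactly when \<tau> lies in \<open>K\<close>.\<close>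

lemma boundary_cone: "ball_boundary F (cone_off x B B) = cone_off x B K"
proof (rule set_eqI)
  fix \<sigma>
  show "\<sigma> \<in> ball_boundary F (cone_off x B B) \<longleftrightarrow> \<sigma> \<in> cone_off x B K"
  proof (cases "x \<in> \<sigma>")
    case True
    then have \<sigma>: "\<sigma> = insert x (\<sigma> - {x})" by blast
    have "link (cone_off x B B) \<sigma> = link B (\<sigma> - {x})" if "\<sigma> - {x} \<in> B"
      using C.link_cone_off_apex[OF that] \<sigma> by simp
    then show ?thesis
      using True mem_cone_off[OF fresh_B subset_refl, of \<sigma>] mem_cone_off[OF fresh_B K_sub_B, of \<sigma>]
      by (auto simp: ball_boundary_def)
  next
    case False
    have "homology_acyclic F (link (cone_off x B B) \<sigma>)" if "\<sigma> \<in> B"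
    proof -
      have "x \<notin> \<Union>(link B \<sigma>)" using fresh_B by (auto simp: link_def)
      then show ?thesis
        using acyclic_cone[OF complex_link[OF complex_B that]] C.link_cone_off[OF that] by simp
    qed
    then show ?thesis
      using False mem_cone_off[OF fresh_B subset_refl, of \<sigma>] mem_cone_off[OF fresh_B K_sub_B, of \<sigma>]
      by (auto simp: ball_boundary_def)
  qed
qed

text \<open>Three kinds of faces: those with \<open>x\<close> have links of the sphere
  \<open>K\<close>; those in \<open>K\<close> have an acyclic link in \<open>B\<close> coned off
  along a sphere, so the homology shift applies; interior faces keep their link in \<open>B\<close>.
  An interior face is nonempty as \<open>K\<close> contains \<open>{}\<close>, so the link condition
  for balls applies to it.\<close>

lemma sphere_S: "homology_sphere F d (cone_off x B K)"
  unfolding homology_sphere_def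
proof (intro conjI ballI)
  show "complex (cone_off x B K)" by (rule S.complex_S)
  obtain \<sigma> where "\<sigma> \<in> B" "face_dim \<sigma> = d" using exists_face_of_dim[OF complex_B dim_B] .
  then show "complex_dim (cone_off x B K) = d"
    using S.dim_cone_off[of d \<sigma>] dim_B dim_K S.L_sub_S by auto
  fix \<sigma> assume \<sigma>: "\<sigma> \<in> cone_off x B K"
  show "has_sphere_homology F (d - face_dim \<sigma> - 1) (link (cone_off x B K) \<sigma>)"
  proof (cases "x \<in> \<sigma>")
    case True
    then obtain \<tau> where \<tau>: "\<sigma> = insert x \<tau>" "\<tau> \<in> K" using \<sigma> fresh_B by (auto simp: cone_off_def)
    have "x \<notin> \<tau>" "finite \<tau>" using \<tau>(2) K_sub_B fresh_B complex_K by (auto simp: complex_def)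
    then have "face_dim \<sigma> = face_dim \<tau> + 1" using \<tau>(1) by (simp add: face_dim_def)
    moreover have "has_sphere_homology F (d - 1 - face_dim \<tau> - 1) (link K \<tau>)"
      using sphere_K \<tau>(2) by (simp add: homology_sphere_def)
    ultimately show ?thesis using S.link_cone_off_apex[OF \<tau>(2)] \<tau>(1) by (simp add: algebra_simps)
  next
    case False
    then have sB: "\<sigma> \<in> B" using \<sigma> mem_cone_off[OF fresh_B K_sub_B, of \<sigma>] by simp
    show ?thesis
    proof (cases "\<sigma> \<in> K")
      case True
      interpret lk: coned_off x "link B \<sigma>" "link K \<sigma>"
        by unfold_locales
          (use complex_link complex_B complex_K sB True K_sub_B fresh_B in \<open>auto simp: link_def\<close>)
      have "homology_acyclic F (link B \<sigma>)" using True by (simp add: ball_boundary_def)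
      moreover have "has_sphere_homology F (d - 1 - face_dim \<sigma> - 1) (link K \<sigma>)"
        using sphere_K True by (simp add: homology_sphere_def)
      ultimately have "has_sphere_homology F (d - 1 - face_dim \<sigma> - 1 + 1)
          (cone_off x (link B \<sigma>) (link K \<sigma>))"
        by (rule lk.sphere_homology_cone_off)
      then show ?thesis using S.link_cone_off[OF sB] by simp
    next
      case False
      then have "\<sigma> \<noteq> {}" "\<not> homology_acyclic F (link B \<sigma>)"
        using empty_K sB by (auto simp: ball_boundary_def)
      then have "has_sphere_homology F (d - face_dim \<sigma> - 1) (link B \<sigma>)" using link_B sB by blast
      moreover have "link K \<sigma> = {}"
        using False complex_K unfolding link_def complex_def by (metis (no_types, lifting) Un_upper2 empty_Collect_eq)
      ultimately show ?thesis using S.link_cone_off[OF sB] by (simp add: cone_off_def)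
    qed
  qed
qed

text \<open>Faces of the boundary have acyclic links by definition. The others are
  \<open>insert x \<tau>\<close> with \<tau> interior, and their links are those of \<tau> in
  \<open>B\<close>.\<close>

lemma ball_cone: "homology_ball F (d + 1) (cone_off x B B)"
  unfolding homology_ball_def
proof (intro conjI ballI impI)
  show "complex (cone_off x B B)" by (rule C.complex_S)
  obtain \<sigma> where \<sigma>: "\<sigma> \<in> B" "face_dim \<sigma> = d" using exists_face_of_dim[OF complex_B dim_B] .
  then have "x \<notin> \<sigma>" "finite \<sigma>" using fresh_B complex_B by (auto simp: complex_def)
  then have "face_dim (insert x \<sigma>) = d + 1" using \<sigma> by (simp add: face_dim_def)
  moreover have "insert x \<sigma> \<in> cone_off x B B" using \<sigma> by (simp add: cone_off_def)
  ultimately show "complex_dim (cone_off x B B) = d + 1"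
    using C.dim_cone_off[of "d + 1" "insert x \<sigma>"] dim_B by simp
  show "homology_acyclic F (cone_off x B B)" using acyclic_cone complex_B fresh_B .
  show "homology_sphere F (d + 1 - 1) (ball_boundary F (cone_off x B B))"
    using sphere_S boundary_cone by simp
  fix \<sigma> assume \<sigma>: "\<sigma> \<in> cone_off x B B"
  show "has_sphere_homology F (d + 1 - face_dim \<sigma> - 1) (link (cone_off x B B) \<sigma>) \<or>
      homology_acyclic F (link (cone_off x B B) \<sigma>)"
  proof (cases "\<sigma> \<in> cone_off x B K")
    case True
    then show ?thesis using boundary_cone by (auto simp: ball_boundary_def)
  next
    case False
    then obtain \<tau> where \<tau>: "\<sigma> = insert x \<tau>" "\<tau> \<in> B" "\<tau> \<notin> K" using \<sigma> by (auto simp: cone_off_def)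
    then have "\<tau> \<noteq> {}" "\<not> homology_acyclic F (link B \<tau>)" using empty_K by (auto simp: ball_boundary_def)
    then have "has_sphere_homology F (d - face_dim \<tau> - 1) (link B \<tau>)" using link_B \<tau> by blast
    moreover have "x \<notin> \<tau>" "finite \<tau>" using \<tau>(2) fresh_B complex_B by (auto simp: complex_def)
    then have "face_dim \<sigma> = face_dim \<tau> + 1" using \<tau>(1) by (simp add: face_dim_def)
    ultimately show ?thesis using C.link_cone_off_apex[OF \<tau>(2)] \<tau>(1) by simp
  qed
qed

text \<open>All of \<open>B\<close> lies in the boundary of the cone. For
  \<open>insert x \<tau>\<close> both the face and the ambient ball gain one dimension, so the
  codimension is that of \<tau> in \<open>B\<close>.\<close>

lemma stacked_sphere_cone_off:
  assumes "stacked_ball F d k B"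
  shows "stacked_sphere F d k (cone_off x B K)"
proof -
  have k: "int k \<le> d" and st: "\<And>\<alpha>. \<alpha> \<in> B \<Longrightarrow> face_dim \<alpha> \<le> d - int k - 1 \<Longrightarrow> \<alpha> \<in> K"
    using assms by (auto simp: stacked_ball_def)
  have "\<alpha> \<in> cone_off x B K"
    if \<alpha>: "\<alpha> \<in> cone_off x B B" "face_dim \<alpha> \<le> d + 1 - int k - 1" for \<alpha>
  proof (cases "\<alpha> \<in> B")
    case False
    then obtain \<tau> where \<tau>: "\<alpha> = insert x \<tau>" "\<tau> \<in> B" using \<alpha> by (auto simp: cone_off_def)
    then have "x \<notin> \<tau>" "finite \<tau>" using fresh_B complex_B by (auto simp: complex_def)
    then have "face_dim \<tau> \<le> d - int k - 1" using \<alpha>(2) \<tau>(1) by (simp add: face_dim_def)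
    then show ?thesis using st \<tau> by (simp add: cone_off_def)
  qed (simp add: cone_off_def)
  then have "stacked_ball F (d + 1) k (cone_off x B B)"
    using k ball_cone boundary_cone by (simp add: stacked_ball_def)
  then show ?thesis using sphere_S boundary_cone unfolding stacked_sphere_def by metis
qed

end

lemma stacked_antistar:
  fixes B :: "'v::infinite set set" and F :: "'f::field itself"
  assumes "stacked_ball F d k B"
  shows "\<exists>S x. stacked_sphere F d k S \<and> {x} \<in> S \<and> B = antistar x S"
proof -
  have ball: "homology_ball F d B" using assms by (simp add: stacked_ball_def)
  then have "finite (\<Union>B)" by (intro finite_vertices) (simp add: homology_ball_def)
  then obtain x where x: "x \<notin> \<Union>B" using ex_new_if_finite infinite_UNIV by blast
  interpret fresh_ball F d B x by unfold_locales fact+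
  have "{x} \<in> cone_off x B K" using empty_K by (auto simp: cone_off_def)
  then show ?thesis using stacked_sphere_cone_off[OF assms] antistar_cone_off[OF x] by metis
qed

section \<open>Shellings\<close>

text \<open>Turns the joins in both kinds of moves into inclusion tests, so that complexes can be
  compared face by face.\<close>

lemma join_closure_boundary:
  assumes "\<alpha> \<inter> \<beta> = {}"
  shows "join (simplex_closure \<alpha>) (simplex_boundary \<beta>) = {\<gamma>. \<gamma> \<subseteq> \<alpha> \<union> \<beta> \<and> \<not> \<beta> \<subseteq> \<gamma>}"
proof (intro set_eqI iffI)
  fix \<gamma> assume "\<gamma> \<in> {\<gamma>. \<gamma> \<subseteq> \<alpha> \<union> \<beta> \<and> \<not> \<beta> \<subseteq> \<gamma>}"
  then have "\<gamma> = (\<gamma> \<inter> \<alpha>) \<union> (\<gamma> \<inter> \<beta>)" "\<gamma> \<inter> \<alpha> \<subseteq> \<alpha>" "\<gamma> \<inter> \<beta> \<subset> \<beta>" by auto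
  then show "\<gamma> \<in> join (simplex_closure \<alpha>) (simplex_boundary \<beta>)"
    unfolding join_def simplex_boundary_def by blast
qed (use assms in \<open>auto simp: join_def simplex_boundary_def\<close>)

lemma join_boundary_closure:
  assumes "\<alpha> \<inter> \<beta> = {}"
  shows "join (simplex_boundary \<alpha>) (simplex_closure \<beta>) = {\<gamma>. \<gamma> \<subseteq> \<alpha> \<union> \<beta> \<and> \<not> \<alpha> \<subseteq> \<gamma>}"
proof -
  have "join (simplex_boundary \<alpha>) (simplex_closure \<beta>) = join (simplex_closure \<beta>) (simplex_boundary \<alpha>)"
    unfolding join_def by blast
  then show ?thesis using assms join_closure_boundary[of \<beta> \<alpha>] by (simp add: Un_commute Int_commute)
qed

section \<open>Parity and stars of faces\<close>

lemma card_Suc_complement: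
  assumes "finite F" "\<tau> \<subseteq> F" "card F = Suc (card \<tau>)"
  obtains v where "v \<in> F" "\<tau> = F - {v}"
proof -
  have "card (F - \<tau>) = 1" using assms by (simp add: card_Diff_subset finite_subset)
  then obtain v where "F - \<tau> = {v}" by (auto simp: card_1_singleton_iff)
  then show thesis using that assms(2) by blast
qed

text \<open>Chains modulo two are encoded as sets of faces, and their sum is the symmetric
  difference.\<close>

lemma even_card_symdiff:
  assumes "finite A" "finite B" "even (card A)" "even (card B)"
  shows "even (card ((A - B) \<union> (B - A)))"
proof -
  have 1: "card ((A - B) \<union> (B - A)) = card (A - B) + card (B - A)"
    using assms by (intro card_Un_disjoint) auto
  have "card A = card (A - B) + card (A \<inter> B)" "card B = card (B - A) + card (A \<inter> B)"
    using assms by (auto simp: card_Diff_subset_Int Int_commute card_mono)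
  with 1 assms(3,4) show ?thesis by presburger
qed

text \<open>Links are not formed. A face of the link of \<open>e\<close> is represented by its union
  with \<open>e\<close>, so that the cardinalities of facets and ridges do not depend on
  \<open>e\<close>.\<close>

definition star_facets :: "'v set set \<Rightarrow> 'v set \<Rightarrow> 'v set set" where
  "star_facets X \<rho> = {\<sigma> \<in> facets X. \<rho> \<subseteq> \<sigma>}"

definition ridges :: "nat \<Rightarrow> 'v set set \<Rightarrow> 'v set \<Rightarrow> 'v set set" where
  "ridges m X e = {\<rho> \<in> X. card \<rho> = m \<and> e \<subseteq> \<rho>}"

text \<open>This says that, for complexes with facets of cardinality \<open>m + 1\<close>, every cycle of codimension
  one with coefficients modulo two in the link of \<open>e\<close> bounds.\<close>

definition fillable :: "nat \<Rightarrow> 'v set set \<Rightarrow> 'v set \<Rightarrow> bool" where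
  "fillable m X e \<longleftrightarrow> (\<forall>Z \<subseteq> ridges m X e.
     (\<forall>\<tau>. e \<subseteq> \<tau> \<and> Suc (card \<tau>) = m \<and> finite \<tau> \<longrightarrow> even (card {\<rho> \<in> Z. \<tau> \<subseteq> \<rho>})) \<longrightarrow>
     (\<exists>G \<subseteq> star_facets X e. \<forall>\<rho>. e \<subseteq> \<rho> \<and> card \<rho> = m \<and> finite \<rho> \<longrightarrow>
        (\<rho> \<in> Z \<longleftrightarrow> odd (card {\<sigma> \<in> G. \<rho> \<subseteq> \<sigma>}))))"

lemma fillableE:
  assumes fill: "fillable m X e" and Z: "Z \<subseteq> ridges m X e"
    and ev: "\<And>\<tau>. e \<subseteq> \<tau> \<Longrightarrow> Suc (card \<tau>) = m \<Longrightarrow> finite \<tau> \<Longrightarrow> even (card {\<rho> \<in> Z. \<tau> \<subseteq> \<rho>})"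
  obtains G where "G \<subseteq> star_facets X e"
    "\<And>\<rho>. e \<subseteq> \<rho> \<Longrightarrow> card \<rho> = m \<Longrightarrow> finite \<rho> \<Longrightarrow> \<rho> \<in> Z \<longleftrightarrow> odd (card {\<sigma> \<in> G. \<rho> \<subseteq> \<sigma>})"
proof -
  have "\<forall>\<tau>. e \<subseteq> \<tau> \<and> Suc (card \<tau>) = m \<and> finite \<tau> \<longrightarrow> even (card {\<rho> \<in> Z. \<tau> \<subseteq> \<rho>})"
    using ev by simp
  from fill[unfolded fillable_def, THEN spec, THEN mp, OF Z, THEN mp, OF this] that
  show thesis by meson
qed

text \<open>Strong connectivity of the link of \<open>e\<close>, stated through sets closed under
  adjacency instead of paths, because it is applied to the support of a cycle. It holds vacuously
  for an empty star.\<close>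

definition star_connected :: "nat \<Rightarrow> 'v set set \<Rightarrow> 'v set \<Rightarrow> bool" where
  "star_connected m X e \<longleftrightarrow> (\<forall>G \<subseteq> star_facets X e. G \<noteq> {} \<longrightarrow>
     (\<forall>\<sigma> \<in> G. \<forall>\<tau> \<in> star_facets X e. card (\<sigma> \<inter> \<tau>) = m \<longrightarrow> \<tau> \<in> G) \<longrightarrow> G = star_facets X e)"

lemma star_connectedD:
  assumes "star_connected m X e" "G \<subseteq> star_facets X e" "G \<noteq> {}"
    and "\<And>\<sigma> \<tau>. \<sigma> \<in> G \<Longrightarrow> \<tau> \<in> star_facets X e \<Longrightarrow> card (\<sigma> \<inter> \<tau>) = m \<Longrightarrow> \<tau> \<in> G"
  shows "G = star_facets X e"
  using assms unfolding star_connected_def by simp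

text \<open>The empty family is admitted for \<open>Y\<close>, so that the initial simplex is attached as well, with
  \<open>b = {}\<close>.\<close>

locale attachment =
  fixes m :: nat and a b :: "'v set" and Y X :: "'v set set"
  assumes disjoint: "a \<inter> b = {}"
    and finite_F: "finite (a \<union> b)"
    and card_F: "card (a \<union> b) = Suc m"
    and X_eq: "X = Y \<union> Pow (a \<union> b)"
    and facets_X: "facets X = insert (a \<union> b) (facets Y)"
    and mem_Y: "\<And>\<gamma>. \<gamma> \<subseteq> a \<union> b \<Longrightarrow> \<gamma> \<in> Y \<longleftrightarrow> \<not> b \<subseteq> \<gamma>"
    and finite_Y: "finite Y"
    and down_Y: "\<And>\<gamma> \<delta>. \<gamma> \<in> Y \<Longrightarrow> \<delta> \<subseteq> \<gamma> \<Longrightarrow> \<delta> \<in> Y"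
    and in_facet: "\<And>\<gamma>. \<gamma> \<in> Y \<Longrightarrow> \<exists>\<sigma>\<in>facets Y. \<gamma> \<subseteq> \<sigma>"
    and card_facet: "\<And>\<sigma>. \<sigma> \<in> facets Y \<Longrightarrow> card \<sigma> = Suc m"
begin

abbreviation "F \<equiv> a \<union> b"

lemma facets_sub: "facets Y \<subseteq> Y" by (auto simp: facets_def)

text \<open>The least new face is \<open>b\<close>: it is not in \<open>Y\<close> by
  \<open>mem_Y\<close>, and \<open>Y\<close> is closed under subsets.\<close>

lemma b_notin: "\<gamma> \<in> Y \<Longrightarrow> \<not> b \<subseteq> \<gamma>"
  using down_Y mem_Y[of b] by blast

lemma F_notin: "F \<notin> Y"
  using b_notin by blast

lemma F_not_sub: "\<sigma> \<in> facets Y \<Longrightarrow> \<not> F \<subseteq> \<sigma>"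
  using facets_sub b_notin by blast

lemma finite_facets: "finite (facets X)" "finite (facets Y)"
  using facets_X finite_Y facets_sub finite_subset by auto

lemma star_facets_X:
  "star_facets X e = (if e \<subseteq> F then insert F (star_facets Y e) else star_facets Y e)"
  by (auto simp: star_facets_def facets_X)

lemma finite_star_facets: "finite (star_facets X e)" "finite (star_facets Y e)"
  using finite_facets by (auto simp: star_facets_def)

lemma ridge_of_F:
  assumes "\<rho> \<subseteq> F" "card \<rho> = m"
  obtains v where "v \<in> F" "\<rho> = F - {v}"
  using card_Suc_complement[OF finite_F assms(1)] assms card_F by metis

lemma card_ridge: "v \<in> F \<Longrightarrow> card (F - {v}) = m"
  using card_F finite_F by simp

lemma ridge_inj: "v \<in> F \<Longrightarrow> F - {v} = F - {w} \<Longrightarrow> v = w"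
  by blast

lemma F_ridge_in_Y: "v \<in> F \<Longrightarrow> F - {v} \<in> Y \<longleftrightarrow> v \<in> b"
  using mem_Y[of "F - {v}"] by blast

text \<open>The boundary of the facet is a cycle modulo two: a codimension-two face inside
  \<open>F\<close> lies in exactly two ridges of \<open>F\<close>, any other in none.\<close>

lemma even_card_F_ridges:
  assumes "e \<subseteq> \<tau>" "Suc (card \<tau>) = m" "V = F - e"
  shows "even (card {\<rho> \<in> (\<lambda>v. F - {v}) ` V. \<tau> \<subseteq> \<rho>})"
proof (cases "\<tau> \<subseteq> F")
  case True
  have "card (F - \<tau>) = 2"
    using True assms card_F finite_F by (simp add: card_Diff_subset finite_subset)
  moreover have "{\<rho> \<in> (\<lambda>v. F - {v}) ` V. \<tau> \<subseteq> \<rho>} = (\<lambda>v. F - {v}) ` (F - \<tau>)"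
    using assms True by auto
  moreover have "inj_on (\<lambda>v. F - {v}) (F - \<tau>)"
    by (auto simp: inj_on_def)
  ultimately show ?thesis by (simp add: card_image)
next
  case False
  then have "{\<rho> \<in> (\<lambda>v. F - {v}) ` V. \<tau> \<subseteq> \<rho>} = {}" by auto
  then show ?thesis by (simp only: card.empty even_zero)
qed

text \<open>A cycle inside \<open>Y\<close> is filled in \<open>Y\<close>. Any other cycle contains
  all ridges of \<open>F\<close> that contain \<open>e\<close> and are new; adding the boundary of
  \<open>F\<close> removes them, and \<open>F\<close> is added to a filling of the result.\<close>

lemma fillable_step:
  assumes Y: "fillable m Y e"
  shows "fillable m X e"
  unfolding fillable_def
proof (intro allI impI)
  fix Z
  assume ZX: "Z \<subseteq> ridges m X e"
    and ev: "\<forall>\<tau>. e \<subseteq> \<tau> \<and> Suc (card \<tau>) = m \<and> finite \<tau> \<longrightarrow> even (card {\<rho> \<in> Z. \<tau> \<subseteq> \<rho>})"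
  let ?concl = "\<exists>G \<subseteq> star_facets X e. \<forall>\<rho>. e \<subseteq> \<rho> \<and> card \<rho> = m \<and> finite \<rho> \<longrightarrow>
        (\<rho> \<in> Z \<longleftrightarrow> odd (card {\<sigma> \<in> G. \<rho> \<subseteq> \<sigma>}))"
  have old: ?concl if "Z \<subseteq> Y"
  proof -
    have "Z \<subseteq> ridges m Y e" using that ZX by (auto simp: ridges_def)
    from Y this obtain G where "G \<subseteq> star_facets Y e"
      "\<And>\<rho>. e \<subseteq> \<rho> \<Longrightarrow> card \<rho> = m \<Longrightarrow> finite \<rho> \<Longrightarrow> \<rho> \<in> Z \<longleftrightarrow> odd (card {\<sigma> \<in> G. \<rho> \<subseteq> \<sigma>})"
      by (rule fillableE) (use ev in auto)
    then show ?thesis by (intro exI[of _ G]) (auto simp: star_facets_X)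
  qed
  have new: "\<exists>v \<in> a - e. \<rho> = F - {v}" if \<rho>: "\<rho> \<in> Z" "\<rho> \<notin> Y" for \<rho>
  proof -
    have r: "\<rho> \<subseteq> F" "card \<rho> = m" "e \<subseteq> \<rho>" using \<rho> ZX X_eq by (auto simp: ridges_def)
    then obtain v where v: "v \<in> F" "\<rho> = F - {v}" using ridge_of_F by blast
    with \<rho>(2) F_ridge_in_Y r show ?thesis by blast
  qed
  have finZ: "finite Z"
    using ZX finite_Y finite_F finite_subset[of Z X] X_eq by (auto simp: ridges_def)
  show ?concl
  proof (cases "Z \<subseteq> Y")
    case True
    then show ?thesis by (rule old)
  next
    case False
    then obtain v where v: "v \<in> a - e" "F - {v} \<in> Z" using new by blast
    then have eF: "e \<subseteq> F" using ZX by (auto simp: ridges_def)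
    \<comment> \<open>Since \<open>v\<close> and \<open>w\<close> lie in \<open>a\<close>, the face
      \<open>F - {v, w}\<close> contains \<open>b\<close>, so only new ridges contain it. Were
      \<open>F - {w}\<close> missing, exactly one member of \<open>Z\<close> would contain this
      face.\<close>
    have all: "F - {w} \<in> Z" if w: "w \<in> a - e" for w
    proof (rule ccontr)
      assume nw: "F - {w} \<notin> Z"
      then have vw: "v \<noteq> w" using v by auto
      have "Suc (card (F - {v, w})) = m"
      proof -
        have "F - {v, w} = F - {v} - {w}" by blast
        then have "Suc (card (F - {v, w})) = card (F - {v})"
          using card_Suc_Diff1[of "F - {v}" w] w v vw finite_F by auto
        then show ?thesis using card_ridge v by auto
      qed
      then have "even (card {\<rho> \<in> Z. F - {v, w} \<subseteq> \<rho>})"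
        by (intro ev[rule_format]) (use v w eF finite_F in auto)
      moreover have "{\<rho> \<in> Z. F - {v, w} \<subseteq> \<rho>} = {F - {v}}"
      proof (intro set_eqI iffI)
        fix \<rho> assume \<rho>: "\<rho> \<in> {\<rho> \<in> Z. F - {v, w} \<subseteq> \<rho>}"
        then have "b \<subseteq> \<rho>" using v w disjoint by blast
        then have "\<rho> \<notin> Y" using b_notin by blast
        then obtain u where u: "u \<in> a - e" "\<rho> = F - {u}" using new \<rho> by blast
        then have "u \<noteq> w" "u = v \<or> u = w" using \<rho> nw by auto
        then show "\<rho> \<in> {F - {v}}" using u(2) by simp
      qed (use v in auto)
      ultimately show False by simp
    qed
    \<comment> \<open>The boundary of \<open>F\<close> in the link of \<open>e\<close>;
      \<open>Z'\<close> is its sum modulo two with \<open>Z\<close>.\<close>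
    define R where "R = (\<lambda>v. F - {v}) ` (F - e)"
    define Z' where "Z' = (Z - R) \<union> (R - Z)"
    have Z'Y: "Z' \<subseteq> ridges m Y e"
    proof
      fix \<rho> assume "\<rho> \<in> Z'"
      then consider "\<rho> \<in> Z" "\<rho> \<notin> R" | "\<rho> \<in> R" "\<rho> \<notin> Z" by (auto simp: Z'_def)
      then show "\<rho> \<in> ridges m Y e"
      proof cases
        case 1
        then have "\<rho> \<in> Y" using new by (auto simp: R_def)
        then show ?thesis using 1 ZX by (auto simp: ridges_def)
      next
        case 2
        then obtain u where u: "u \<in> F - e" "\<rho> = F - {u}" by (auto simp: R_def)
        then have "u \<in> b" using all 2 by blast
        then show ?thesis using u eF F_ridge_in_Y card_ridge[of u] by (auto simp: ridges_def)
      qed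
    qed
    have evZ': "even (card {\<rho> \<in> Z'. \<tau> \<subseteq> \<rho>})" if \<tau>: "e \<subseteq> \<tau>" "Suc (card \<tau>) = m" "finite \<tau>" for \<tau>
    proof -
      have "{\<rho> \<in> Z'. \<tau> \<subseteq> \<rho>} = ({\<rho> \<in> Z. \<tau> \<subseteq> \<rho>} - {\<rho> \<in> R. \<tau> \<subseteq> \<rho>}) \<union> ({\<rho> \<in> R. \<tau> \<subseteq> \<rho>} - {\<rho> \<in> Z. \<tau> \<subseteq> \<rho>})"
        by (auto simp: Z'_def)
      moreover have "even (card {\<rho> \<in> R. \<tau> \<subseteq> \<rho>})"
        using even_card_F_ridges[OF \<tau>(1,2)] by (auto simp: R_def)
      moreover have "finite R" using finite_F by (simp add: R_def)
      ultimately show ?thesis using ev \<tau> finZ by (simp only:) (rule even_card_symdiff; simp)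
    qed
    from Y Z'Y obtain G where G: "G \<subseteq> star_facets Y e"
      "\<And>\<rho>. e \<subseteq> \<rho> \<Longrightarrow> card \<rho> = m \<Longrightarrow> finite \<rho> \<Longrightarrow> \<rho> \<in> Z' \<longleftrightarrow> odd (card {\<sigma> \<in> G. \<rho> \<subseteq> \<sigma>})"
      by (rule fillableE) (erule (2) evZ', rule that)
    have FG: "F \<notin> G" "finite G"
      using G(1) F_notin facets_sub finite_subset[OF G(1) finite_star_facets(2)]
      by (auto simp: star_facets_def)
    \<comment> \<open>Adding \<open>F\<close> changes the parity exactly at the ridges in
      \<open>R\<close>, which turns a filling of \<open>Z'\<close> into one of
      \<open>Z\<close>.\<close>
    have par: "\<rho> \<in> Z \<longleftrightarrow> odd (card {\<sigma> \<in> insert F G. \<rho> \<subseteq> \<sigma>})"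
      if \<rho>: "e \<subseteq> \<rho>" "card \<rho> = m" "finite \<rho>" for \<rho>
    proof (cases "\<rho> \<subseteq> F")
      case True
      then obtain v where "v \<in> F" "\<rho> = F - {v}" using ridge_of_F \<rho>(2) by blast
      then have "\<rho> \<in> R" using \<rho>(1) by (auto simp: R_def)
      then have "\<rho> \<in> Z \<longleftrightarrow> even (card {\<sigma> \<in> G. \<rho> \<subseteq> \<sigma>})" using G(2)[OF \<rho>] by (auto simp: Z'_def)
      moreover have "{\<sigma> \<in> insert F G. \<rho> \<subseteq> \<sigma>} = insert F {\<sigma> \<in> G. \<rho> \<subseteq> \<sigma>}" using True by auto
      ultimately show ?thesis using FG by simp
    next
      case False
      then have "\<rho> \<notin> R" by (auto simp: R_def)
      moreover have "{\<sigma> \<in> insert F G. \<rho> \<subseteq> \<sigma>} = {\<sigma> \<in> G. \<rho> \<subseteq> \<sigma>}" using False by auto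
      ultimately show ?thesis using G(2)[OF \<rho>] by (auto simp: Z'_def)
    qed
    show ?thesis
    proof (intro exI[of _ "insert F G"] conjI allI impI)
      show "insert F G \<subseteq> star_facets X e" using G(1) eF by (auto simp: star_facets_X)
    qed (elim conjE, rule par)
  qed
qed

lemma facet_meets_F:
  assumes "v \<in> b" "\<sigma> \<in> facets Y" "F - {v} \<subseteq> \<sigma>"
  shows "\<sigma> \<inter> F = F - {v}"
  using assms F_not_sub[of \<sigma>] by blast

text \<open>The only interesting case has \<open>e\<close> inside \<open>F\<close> and an old star
  that is nonempty. Then \<open>e\<close> is an old face, so some \<open>v\<close> in
  \<open>b\<close> is not in \<open>e\<close>. The ridge \<open>F - {v}\<close> is old, contains
  \<open>e\<close>, and lies in an old facet; this facet is adjacent to \<open>F\<close>.\<close>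

lemma star_connected_step:
  assumes Y: "star_connected m Y e"
  shows "star_connected m X e"
proof (cases "e \<subseteq> F \<and> star_facets Y e \<noteq> {}")
  case False
  then show ?thesis using Y by (auto simp: star_connected_def star_facets_X)
next
  case True
  then have "e \<in> Y" using facets_sub down_Y by (auto simp: star_facets_def)
  then obtain v where v: "v \<in> b" "v \<notin> e" using b_notin by blast
  then have "F - {v} \<in> Y" using F_ridge_in_Y by blast
  then obtain \<sigma>0 where s0: "\<sigma>0 \<in> facets Y" "F - {v} \<subseteq> \<sigma>0" using in_facet by blast
  then have s0F: "card (\<sigma>0 \<inter> F) = m" using facet_meets_F[OF v(1) s0] card_ridge[of v] v by simp
  have s0e: "\<sigma>0 \<in> star_facets Y e" using s0 v True by (auto simp: star_facets_def)
  show ?thesis unfolding star_connected_def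
  proof (intro allI impI)
    fix G assume G: "G \<subseteq> star_facets X e" "G \<noteq> {}"
      and cl: "\<forall>\<sigma>\<in>G. \<forall>\<tau>\<in>star_facets X e. card (\<sigma> \<inter> \<tau>) = m \<longrightarrow> \<tau> \<in> G"
    have X: "star_facets X e = insert F (star_facets Y e)" using True by (simp add: star_facets_X)
    have GY: "G \<inter> star_facets Y e = star_facets Y e" if "G \<inter> star_facets Y e \<noteq> {}"
      using Y that cl X unfolding star_connected_def by auto
    have "F \<in> G \<longleftrightarrow> \<sigma>0 \<in> G"
      using cl s0F s0e X by (metis Int_commute insertCI)
    then have "F \<in> G" "G \<inter> star_facets Y e = star_facets Y e" using GY G X s0e by auto
    then show "G = star_facets X e" using G X by auto
  qed
qed

text \<open>Fill the ridges of \<open>F\<close> around \<open>a\<close> that are already in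
  \<open>Y\<close>. Together with \<open>F\<close>, the filling is a cycle modulo two in the star of
  \<open>a\<close>, and by connectivity it is the whole star, so no ridge around \<open>a\<close> is
  in just one facet of \<open>X\<close>.\<close>

lemma free_ridge_in_star:
  assumes fill: "fillable m Y a" and conn: "star_connected m X a"
    and weak: "\<And>\<rho>. \<rho> \<in> X \<Longrightarrow> card \<rho> = m \<Longrightarrow> card (star_facets X \<rho>) \<le> 2"
    and \<rho>: "\<rho> \<in> Y" "card \<rho> = m" "finite \<rho>" "a \<subseteq> \<rho>" "card (star_facets Y \<rho>) = 1"
  obtains w where "w \<in> b" "\<rho> = F - {w}"
proof -
  define Z where "Z = (\<lambda>v. F - {v}) ` b"
  have b: "b = F - a" using disjoint by blast
  have ZY: "Z \<subseteq> ridges m Y a"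
    using F_ridge_in_Y card_ridge disjoint card_F by (auto simp: Z_def ridges_def)
  have evZ: "even (card {\<rho> \<in> Z. \<tau> \<subseteq> \<rho>})"
    if "a \<subseteq> \<tau>" "Suc (card \<tau>) = m" "finite \<tau>" for \<tau>
    using even_card_F_ridges[OF that(1,2) b] disjoint by (auto simp: Z_def)
  from fill ZY obtain G where G: "G \<subseteq> star_facets Y a"
      "\<And>\<rho>. a \<subseteq> \<rho> \<Longrightarrow> card \<rho> = m \<Longrightarrow> finite \<rho> \<Longrightarrow> \<rho> \<in> Z \<longleftrightarrow> odd (card {\<sigma> \<in> G. \<rho> \<subseteq> \<sigma>})"
    by (rule fillableE) (erule (2) evZ, rule that)
  have FG: "F \<notin> G" "finite G"
    using G(1) F_notin facets_sub finite_subset[OF G(1) finite_star_facets(2)]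
    by (auto simp: star_facets_def)
  have memZ: "\<rho> \<in> Z \<longleftrightarrow> \<rho> \<subseteq> F" if r: "a \<subseteq> \<rho>" "card \<rho> = m" for \<rho>
  proof
    assume "\<rho> \<subseteq> F"
    then obtain v where v: "v \<in> F" "\<rho> = F - {v}" using ridge_of_F[OF _ r(2)] by metis
    then have "v \<in> b" using r(1) by blast
    then show "\<rho> \<in> Z" using v(2) unfolding Z_def by (rule rev_image_eqI)
  next
    assume "\<rho> \<in> Z"
    then show "\<rho> \<subseteq> F" unfolding Z_def by blast
  qed
  have ev: "even (card {\<sigma> \<in> insert F G. \<rho> \<subseteq> \<sigma>})" if r: "a \<subseteq> \<rho>" "card \<rho> = m" "finite \<rho>" for \<rho>
  proof (cases "\<rho> \<subseteq> F")
    case True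
    then have "{\<sigma> \<in> insert F G. \<rho> \<subseteq> \<sigma>} = insert F {\<sigma> \<in> G. \<rho> \<subseteq> \<sigma>}" by auto
    then show ?thesis using FG G(2)[OF r] memZ[OF r(1,2)] True by simp
  next
    case False
    then have "{\<sigma> \<in> insert F G. \<rho> \<subseteq> \<sigma>} = {\<sigma> \<in> G. \<rho> \<subseteq> \<sigma>}" by auto
    then show ?thesis using G(2)[OF r] memZ[OF r(1,2)] False by simp
  qed
  define H where "H = insert F G"
  have sub: "H \<subseteq> star_facets X a" using G(1) by (auto simp: H_def star_facets_X)
  \<comment> \<open>The support \<open>H\<close> is closed under adjacency: at most two facets
    contain the common ridge, so if only one of them were in \<open>H\<close>, the count would be
    odd.\<close>
  have "\<tau> \<in> H"
    if st: "\<sigma> \<in> H" "\<tau> \<in> star_facets X a" "card (\<sigma> \<inter> \<tau>) = m" for \<sigma> \<tau>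
  proof (rule ccontr)
    assume n: "\<tau> \<notin> H"
    have "\<sigma> \<in> facets X" using st(1) sub by (auto simp: star_facets_def)
    then have "card \<sigma> = Suc m" using facets_X card_facet card_F by auto
    then have fs: "finite \<sigma>" by (intro card_ge_0_finite) simp
    have r: "a \<subseteq> \<sigma> \<inter> \<tau>" using st sub by (auto simp: star_facets_def)
    have "\<sigma> \<in> X" using st sub by (auto simp: star_facets_def facets_def)
    then have "\<sigma> \<inter> \<tau> \<in> X" using X_eq down_Y by auto
    then have c2: "card (star_facets X (\<sigma> \<inter> \<tau>)) \<le> 2" using weak st by blast
    have "{\<sigma>, \<tau>} \<subseteq> star_facets X (\<sigma> \<inter> \<tau>)" using st sub by (auto simp: star_facets_def)
    moreover have "\<sigma> \<noteq> \<tau>" using n st(1) by blast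
    then have "card {\<sigma>, \<tau>} = 2" by simp
    ultimately have "star_facets X (\<sigma> \<inter> \<tau>) = {\<sigma>, \<tau>}"
      using c2 card_seteq[OF finite_star_facets(1), of "{\<sigma>, \<tau>}" "\<sigma> \<inter> \<tau>"] by simp
    moreover have "{\<mu> \<in> H. \<sigma> \<inter> \<tau> \<subseteq> \<mu>} = H \<inter> star_facets X (\<sigma> \<inter> \<tau>)"
      using sub unfolding star_facets_def by blast
    ultimately have "{\<mu> \<in> H. \<sigma> \<inter> \<tau> \<subseteq> \<mu>} = {\<sigma>}"
      using st(1) n by blast
    then show False using ev[of "\<sigma> \<inter> \<tau>", folded H_def] r st fs by simp
  qed
  then have eq: "H = star_facets X a"
    by (intro star_connectedD[OF conn sub]) (auto simp: H_def)
  \<comment> \<open>Outside \<open>F\<close> the facets over \<rho> are the same in \<open>X\<close>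
    and \<open>Y\<close>, so there would be exactly one in the cycle \<open>H\<close>.\<close>
  have "\<rho> \<subseteq> F"
  proof (rule ccontr)
    assume "\<not> \<rho> \<subseteq> F"
    then have "{\<sigma> \<in> H. \<rho> \<subseteq> \<sigma>} = star_facets Y \<rho>"
      using \<rho>(4) unfolding eq star_facets_def facets_X by blast
    then show False using ev[of \<rho>, folded H_def] \<rho> by simp
  qed
  then have "\<rho> \<in> Z" using memZ \<rho> by blast
  then obtain w where "w \<in> b" "\<rho> = F - {w}" unfolding Z_def by blast
  then show thesis by (rule that)
qed

end

section \<open>The combinatorial boundary under attachment\<close>

definition free_ridges :: "nat \<Rightarrow> 'v set set \<Rightarrow> 'v set set" where
  "free_ridges m X = {\<rho> \<in> X. card \<rho> = m \<and> card (star_facets X \<rho>) = 1}"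

text \<open>Defined without homology, since the intermediate complexes of a shelling are not assumed
  to be homology balls. It lacks even \<open>{}\<close> when there are no free ridges.\<close>

definition combinatorial_boundary :: "nat \<Rightarrow> 'v set set \<Rightarrow> 'v set set" where
  "combinatorial_boundary m X = {\<gamma>. \<exists>\<rho>\<in>free_ridges m X. \<gamma> \<subseteq> \<rho>}"

context attachment
begin

lemma star_facets_F_ridge:
  assumes "v \<in> F"
  shows "star_facets X (F - {v}) = insert F (star_facets Y (F - {v}))"
    and "F \<notin> star_facets Y (F - {v})"
    and "v \<in> b \<Longrightarrow> star_facets Y (F - {v}) \<noteq> {}"
    and "v \<in> a \<Longrightarrow> star_facets Y (F - {v}) = {}"
proof -
  show "star_facets X (F - {v}) = insert F (star_facets Y (F - {v}))"
    unfolding star_facets_X by (simp only: Diff_subset if_True)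
  show "F \<notin> star_facets Y (F - {v})"
    using F_notin facets_sub unfolding star_facets_def by blast
  show "star_facets Y (F - {v}) \<noteq> {}" if "v \<in> b"
    using in_facet[of "F - {v}"] F_ridge_in_Y[of v] assms that unfolding star_facets_def by blast
  show "star_facets Y (F - {v}) = {}" if "v \<in> a"
  proof -
    have "F - {v} \<notin> Y" using F_ridge_in_Y[of v] that disjoint by blast
    then show ?thesis using facets_sub down_Y unfolding star_facets_def by blast
  qed
qed

text \<open>Inside \<open>F\<close> a ridge is free in \<open>X\<close> iff no old facet contains
  it, which means that the omitted vertex lies in \<open>a\<close>. Outside \<open>F\<close> nothing
  changes.\<close>

lemma free_ridges_X:
  "\<rho> \<in> free_ridges m X \<longleftrightarrow> (\<rho> \<in> free_ridges m Y \<and> \<not> \<rho> \<subseteq> F) \<or> (\<exists>v\<in>a. \<rho> = F - {v})"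
proof (cases "\<rho> \<subseteq> F \<and> card \<rho> = m")
  case True
  then obtain v where v: "v \<in> F" "\<rho> = F - {v}" using ridge_of_F by metis
  have "\<rho> \<in> X" using True X_eq by blast
  then have "\<rho> \<in> free_ridges m X \<longleftrightarrow> card (star_facets Y \<rho>) = 0"
    using star_facets_F_ridge(1,2)[OF v(1), folded v(2)] True finite_star_facets(2)[of \<rho>]
    by (simp add: free_ridges_def del: card_eq_0_iff card_0_eq)
  also have "\<dots> \<longleftrightarrow> v \<in> a"
    using star_facets_F_ridge(3,4)[OF v(1), folded v(2)] v(1) disjoint finite_star_facets(2)[of \<rho>]
    by auto
  also have "\<dots> \<longleftrightarrow> (\<exists>v\<in>a. \<rho> = F - {v})" using v ridge_inj by metis
  finally show ?thesis using True by blast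
next
  case False
  have "card (F - {v}) = m" if "v \<in> a" for v using card_ridge that by blast
  then have *: "\<not> (\<exists>v\<in>a. \<rho> = F - {v})" using False by blast
  show ?thesis
  proof (cases "card \<rho> = m")
    case True
    then have "\<not> \<rho> \<subseteq> F" using False by blast
    moreover from this have "star_facets X \<rho> = star_facets Y \<rho>" "\<rho> \<in> X \<longleftrightarrow> \<rho> \<in> Y"
      by (simp add: star_facets_X) (use X_eq \<open>\<not> \<rho> \<subseteq> F\<close> in blast)
    ultimately show ?thesis using * unfolding free_ridges_def by simp
  next
    case False
    then show ?thesis using * by (simp add: free_ridges_def)
  qed
qed

context
  assumes fill: "fillable m Y a" and conn: "star_connected m X a"
    and weak: "\<And>\<rho>. \<rho> \<in> X \<Longrightarrow> card \<rho> = m \<Longrightarrow> card (star_facets X \<rho>) \<le> 2"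
begin

text \<open>Such a ridge is old, so some old facet contains it, and \<open>F\<close> is another one.
  The bound by two leaves exactly one in \<open>Y\<close>.\<close>

lemma F_ridge_free:
  assumes "w \<in> b"
  shows "F - {w} \<in> free_ridges m Y"
proof -
  have w: "w \<in> F" using assms by blast
  have Y: "F - {w} \<in> Y" using F_ridge_in_Y w assms by blast
  then have "card (star_facets X (F - {w})) \<le> 2" using weak card_ridge w X_eq by blast
  then have "card (star_facets Y (F - {w})) \<le> 1"
    using star_facets_F_ridge(1,2)[OF w] finite_star_facets(2)[of "F - {w}"] by simp
  moreover have "card (star_facets Y (F - {w})) \<noteq> 0"
    using star_facets_F_ridge(3)[OF w assms] finite_star_facets(2)[of "F - {w}"] by simp
  ultimately have "card (star_facets Y (F - {w})) = 1" by linarith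
  then show ?thesis using Y card_ridge[OF w] unfolding free_ridges_def by blast
qed

text \<open>Inside \<open>F\<close> the boundary of \<open>Y\<close> agrees with \<open>Y\<close>
  itself: the new facet is attached along the boundary only.\<close>

lemma boundary_Y_in_F:
  assumes "\<gamma> \<subseteq> F"
  shows "\<gamma> \<in> combinatorial_boundary m Y \<longleftrightarrow> \<not> b \<subseteq> \<gamma>"
proof
  assume "\<gamma> \<in> combinatorial_boundary m Y"
  then have "\<gamma> \<in> Y" using down_Y by (auto simp: combinatorial_boundary_def free_ridges_def)
  then show "\<not> b \<subseteq> \<gamma>" by (rule b_notin)
next
  assume "\<not> b \<subseteq> \<gamma>"
  then obtain w where "w \<in> b" "w \<notin> \<gamma>" by blast
  then have "F - {w} \<in> free_ridges m Y" "\<gamma> \<subseteq> F - {w}" using F_ridge_free assms by blast+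
  then show "\<gamma> \<in> combinatorial_boundary m Y" unfolding combinatorial_boundary_def by blast
qed

text \<open>The delicate case is a face in \<open>F\<close> that contains \<open>a\<close>. A free
  ridge of \<open>X\<close> above it would be a free ridge of \<open>Y\<close> around
  \<open>a\<close> that is not inside \<open>F\<close>, and \<open>free_ridge_in_star\<close> rules
  this out.\<close>

lemma boundary_X:
  "\<gamma> \<in> combinatorial_boundary m X \<longleftrightarrow>
     (if \<gamma> \<subseteq> F then \<not> a \<subseteq> \<gamma> else \<gamma> \<in> combinatorial_boundary m Y)"
proof (cases "\<gamma> \<subseteq> F")
  case True
  have "\<not> a \<subseteq> \<gamma>" if b: "\<gamma> \<in> combinatorial_boundary m X"
  proof
    assume a: "a \<subseteq> \<gamma>"
    obtain \<rho> where \<rho>: "\<rho> \<in> free_ridges m X" "\<gamma> \<subseteq> \<rho>"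
      using b unfolding combinatorial_boundary_def by blast
    have "\<not> (\<exists>v\<in>a. \<rho> = F - {v})" using a \<rho>(2) by blast
    then have *: "\<rho> \<in> free_ridges m Y" "\<not> \<rho> \<subseteq> F" using \<rho>(1) free_ridges_X by blast+
    then have "\<rho> \<in> Y" "card \<rho> = m" "card (star_facets Y \<rho>) = 1" by (auto simp: free_ridges_def)
    moreover from this obtain \<sigma> where "\<sigma> \<in> facets Y" "\<rho> \<subseteq> \<sigma>" using in_facet by blast
    then have "finite \<rho>" using card_facet finite_subset card_ge_0_finite by (metis zero_less_Suc)
    moreover have "a \<subseteq> \<rho>" using a \<rho>(2) by blast
    ultimately obtain w where "\<rho> = F - {w}"
      using free_ridge_in_star[OF fill conn weak] by metis
    then show False using *(2) by blast
  qed
  moreover have "\<gamma> \<in> combinatorial_boundary m X" if na: "\<not> a \<subseteq> \<gamma>"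
  proof -
    obtain v where "v \<in> a" "v \<notin> \<gamma>" using na by blast
    then have "F - {v} \<in> free_ridges m X" "\<gamma> \<subseteq> F - {v}" using free_ridges_X True by blast+
    then show ?thesis unfolding combinatorial_boundary_def by blast
  qed
  ultimately show ?thesis using True by metis
next
  case False
  have "(\<exists>\<rho>\<in>free_ridges m X. \<gamma> \<subseteq> \<rho>) \<longleftrightarrow> (\<exists>\<rho>\<in>free_ridges m Y. \<gamma> \<subseteq> \<rho>)"
    using free_ridges_X False by blast
  then show ?thesis using False by (simp add: combinatorial_boundary_def)
qed

text \<open>Inside \<open>F\<close>, both \<open>Y\<close> and its boundary consist of the faces not
  containing \<open>b\<close>, so the same test describes the coned complex on
  \<open>insert x F\<close>. After the move a face there is missing iff it contains \<open>x\<close>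
  and all of \<open>a\<close>.\<close>

lemma bistellar_move_cone_off:
  assumes "a \<noteq> {}" "b \<noteq> {}" "x \<notin> \<Union>X"
    and "complex (cone_off x Y (combinatorial_boundary m Y))"
    and "complex_dim (cone_off x Y (combinatorial_boundary m Y)) = int m"
  shows "bistellar_move (int m) (insert x a) b
           (cone_off x Y (combinatorial_boundary m Y)) (cone_off x X (combinatorial_boundary m X))"
proof -
  let ?S = "cone_off x Y (combinatorial_boundary m Y)"
  have x: "x \<notin> a" "x \<notin> b" "x \<notin> \<Union>Y" using assms(3) X_eq by blast+
  have d: "insert x a \<inter> b = {}" using disjoint x by blast
  have BY: "combinatorial_boundary m Y \<subseteq> Y"
    unfolding combinatorial_boundary_def free_ridges_def using down_Y by blast
  have "\<gamma> \<in> X" if "\<gamma> \<in> combinatorial_boundary m X" for \<gamma>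
    using that boundary_X[of \<gamma>] BY X_eq by (cases "\<gamma> \<subseteq> F") auto
  then have BX: "combinatorial_boundary m X \<subseteq> X" by blast
  have sub: "\<gamma> \<subseteq> insert x a \<union> b \<longleftrightarrow> \<gamma> - {x} \<subseteq> F" for \<gamma> by blast
  have bsub: "b \<subseteq> \<gamma> \<longleftrightarrow> b \<subseteq> \<gamma> - {x}" for \<gamma> using x by blast
  have asub: "insert x a \<subseteq> \<gamma> \<longleftrightarrow> x \<in> \<gamma> \<and> a \<subseteq> \<gamma> - {x}" for \<gamma> using x by blast
  have S: "\<gamma> \<in> ?S \<longleftrightarrow> \<not> b \<subseteq> \<gamma>" if "\<gamma> - {x} \<subseteq> F" for \<gamma>
  proof (cases "x \<in> \<gamma>")
    case True
    then show ?thesis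
      using mem_cone_off[OF x(3) BY, of \<gamma>] boundary_Y_in_F[OF that] bsub[of \<gamma>] by simp
  next
    case False
    then show ?thesis using mem_cone_off[OF x(3) BY, of \<gamma>] mem_Y[of \<gamma>] that by simp
  qed
  have "\<gamma> \<in> cone_off x X (combinatorial_boundary m X) \<longleftrightarrow>
      (if \<gamma> - {x} \<subseteq> F then \<not> insert x a \<subseteq> \<gamma> else \<gamma> \<in> ?S)" for \<gamma>
  proof (cases "x \<in> \<gamma>")
    case True
    then show ?thesis
      using mem_cone_off[OF x(3) BY, of \<gamma>] mem_cone_off[OF assms(3) BX, of \<gamma>]
        boundary_X[of "\<gamma> - {x}"] asub[of \<gamma>] by simp
  next
    case False
    then show ?thesis
      using mem_cone_off[OF x(3) BY, of \<gamma>] mem_cone_off[OF assms(3) BX, of \<gamma>]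
        asub[of \<gamma>] X_eq by auto
  qed
  then have X: "cone_off x X (combinatorial_boundary m X) =
      (?S - {\<gamma>. \<gamma> \<subseteq> insert x a \<union> b \<and> \<not> b \<subseteq> \<gamma>}) \<union> {\<gamma>. \<gamma> \<subseteq> insert x a \<union> b \<and> \<not> insert x a \<subseteq> \<gamma>}"
    unfolding sub using S by (auto split: if_splits)
  \<comment> \<open>The \<open>m + 1\<close> vertices of \<open>F\<close> and the apex give
    \<open>m + 2\<close> in total, so the two dimensions add up to \<open>m\<close>.\<close>
  have "card F = card a + card b" using finite_F disjoint by (simp add: card_Un_disjoint)
  then have "face_dim (insert x a) + face_dim b = int m"
    using card_F x finite_F by (simp add: face_dim_def)
  moreover have "induced ?S (insert x a \<union> b) = {\<gamma>. \<gamma> \<subseteq> insert x a \<union> b \<and> \<not> b \<subseteq> \<gamma>}"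
    unfolding induced_def sub using S by blast
  ultimately show ?thesis
    unfolding bistellar_move_def join_closure_boundary[OF d] join_boundary_closure[OF d]
    using assms X d finite_F by simp
qed

end

end

section \<open>From shelling sequences to bistellar sequences: part (b)\<close>

lemma fillable_empty: "fillable m {} e"
  by (auto simp: fillable_def ridges_def intro!: exI[of _ "{}"])

lemma star_connected_empty: "star_connected m {} e"
  by (simp add: star_connected_def star_facets_def facets_def)

lemma attachment_simplex:
  assumes "finite A" "card A = Suc m"
  shows "attachment m A {} {} (Pow A)"
  by unfold_locales (use assms in \<open>auto simp: facets_def\<close>)

lemma complex_in_facet:
  assumes "complex X" "\<gamma> \<in> X"
  shows "\<exists>\<sigma>\<in>facets X. \<gamma> \<subseteq> \<sigma>"
proof -
  have "finite X" using assms(1) by (simp add: complex_def)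
  from finite_has_maximal2[OF this assms(2)] show ?thesis by (auto simp: facets_def)
qed

lemma pure_complex_card_facet:
  assumes "pure_complex (int m) X" "\<sigma> \<in> facets X"
  shows "card \<sigma> = Suc m"
  using assms by (auto simp: pure_complex_def face_dim_def)

lemma pure_complex_card_le:
  assumes "pure_complex (int m) X" "\<sigma> \<in> X"
  shows "card \<sigma> \<le> Suc m"
  using face_dim_le_complex_dim[of X \<sigma>] assms by (auto simp: pure_complex_def face_dim_def)

text \<open>A facet of \<open>Y\<close> already has the largest cardinality possible in
  \<open>X\<close>, so no face of \<open>X\<close> properly contains it.\<close>

lemma facets_mono_pure:
  assumes "pure_complex (int m) Y" "pure_complex (int m) X" "Y \<subseteq> X"
  shows "facets Y \<subseteq> facets X"
proof
  fix \<sigma> assume \<sigma>: "\<sigma> \<in> facets Y"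
  have "\<tau> = \<sigma>" if "\<tau> \<in> X" "\<sigma> \<subseteq> \<tau>" for \<tau>
  proof -
    have "finite \<tau>" using that assms(2) by (auto simp: pure_complex_def complex_def)
    then show ?thesis
      using pure_complex_card_facet[OF assms(1) \<sigma>] pure_complex_card_le[OF assms(2) that(1)] that(2)
      by (metis card_seteq)
  qed
  then show "\<sigma> \<in> facets X" using \<sigma> assms(3) by (auto simp: facets_def)
qed

lemma shelling_move_attachment:
  assumes "shelling_move (int m) \<alpha> \<beta> Y X"
  shows "attachment m \<alpha> \<beta> Y X"
proof -
  have X: "pure_complex (int m) X" and Y: "pure_complex (int m) Y" and sub: "Y \<subseteq> X"
    and dis: "\<alpha> \<inter> \<beta> = {}" and new: "facets X - facets Y = {\<alpha> \<union> \<beta>}"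
    and ind: "induced Y (\<alpha> \<union> \<beta>) = {\<gamma>. \<gamma> \<subseteq> \<alpha> \<union> \<beta> \<and> \<not> \<beta> \<subseteq> \<gamma>}"
    using assms by (auto simp: shelling_move_def join_closure_boundary)
  have cX: "complex X" and cY: "complex Y" using X Y by (auto simp: pure_complex_def)
  have F: "\<alpha> \<union> \<beta> \<in> facets X" "\<alpha> \<union> \<beta> \<notin> facets Y" using new by blast+
  then have FX: "\<alpha> \<union> \<beta> \<in> X" by (simp add: facets_def)
  have fX: "facets X = insert (\<alpha> \<union> \<beta>) (facets Y)" using new facets_mono_pure[OF Y X sub] by blast
  have "\<gamma> \<in> Y \<union> Pow (\<alpha> \<union> \<beta>)" if "\<gamma> \<in> X" for \<gamma>
  proof -
    obtain \<sigma> where "\<sigma> \<in> facets X" "\<gamma> \<subseteq> \<sigma>" using complex_in_facet[OF cX \<open>\<gamma> \<in> X\<close>] by blast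
    then show ?thesis using fX cY unfolding complex_def facets_def by blast
  qed
  moreover have "Pow (\<alpha> \<union> \<beta>) \<subseteq> X" using FX cX unfolding complex_def by blast
  ultimately have X_eq: "X = Y \<union> Pow (\<alpha> \<union> \<beta>)" using sub by blast
  show ?thesis
  proof
    show "\<alpha> \<inter> \<beta> = {}" by fact
    show "finite (\<alpha> \<union> \<beta>)" using FX cX unfolding complex_def by blast
    show "card (\<alpha> \<union> \<beta>) = Suc m" using pure_complex_card_facet[OF X F(1)] .
    show "X = Y \<union> Pow (\<alpha> \<union> \<beta>)" by fact
    show "facets X = insert (\<alpha> \<union> \<beta>) (facets Y)" by fact
    show "finite Y" using cY by (simp add: complex_def)
    show "\<gamma> \<in> Y \<longleftrightarrow> \<not> \<beta> \<subseteq> \<gamma>" if "\<gamma> \<subseteq> \<alpha> \<union> \<beta>" for \<gamma>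
      using ind that unfolding induced_def by blast
    show "\<delta> \<in> Y" if "\<gamma> \<in> Y" "\<delta> \<subseteq> \<gamma>" for \<gamma> \<delta> using cY that unfolding complex_def by blast
    show "\<exists>\<sigma>\<in>facets Y. \<gamma> \<subseteq> \<sigma>" if "\<gamma> \<in> Y" for \<gamma> using complex_in_facet[OF cY that] .
    show "card \<sigma> = Suc m" if "\<sigma> \<in> facets Y" for \<sigma> using pure_complex_card_facet[OF Y that] .
  qed
qed

text \<open>The assumption on \<open>{}\<close> says that there is a free ridge at all.\<close>

lemma complex_combinatorial_boundary:
  assumes "complex X" "{} \<in> combinatorial_boundary m X"
  shows "complex (combinatorial_boundary m X)" "combinatorial_boundary m X \<subseteq> X"
proof -
  show sub: "combinatorial_boundary m X \<subseteq> X"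
    using assms(1) unfolding complex_def combinatorial_boundary_def free_ridges_def by blast
  have "finite (combinatorial_boundary m X)"
    using assms(1) sub finite_subset unfolding complex_def by blast
  moreover have "\<beta> \<in> combinatorial_boundary m X"
    if "\<alpha> \<in> combinatorial_boundary m X" "\<beta> \<subseteq> \<alpha>" for \<alpha> \<beta>
    using that unfolding combinatorial_boundary_def by blast
  ultimately show "complex (combinatorial_boundary m X)"
    using assms sub unfolding complex_def by blast
qed

lemma cone_off_boundary_dim:
  assumes X: "complex X" "complex_dim X = int m" and e: "{} \<in> combinatorial_boundary m X"
  shows "complex (cone_off x X (combinatorial_boundary m X))"
    and "complex_dim (cone_off x X (combinatorial_boundary m X)) = int m"
proof -
  let ?S = "cone_off x X (combinatorial_boundary m X)"
  show c: "complex ?S"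
    by (rule complex_cone_off[OF X(1) complex_combinatorial_boundary[OF X(1) e]])
  obtain \<sigma> where \<sigma>: "\<sigma> \<in> X" "face_dim \<sigma> = int m" using exists_face_of_dim[OF X] .
  show "complex_dim ?S = int m"
  proof (rule complex_dim_eqI)
    show "finite ?S" using c by (simp add: complex_def)
    show "\<sigma> \<in> ?S" using \<sigma> by (simp add: cone_off_def)
    show "face_dim \<sigma> = int m" by fact
    fix \<tau> assume "\<tau> \<in> ?S"
    then consider "\<tau> \<in> X" | \<gamma> where "\<tau> = insert x \<gamma>" "\<gamma> \<in> combinatorial_boundary m X"
      unfolding cone_off_def by blast
    then show "face_dim \<tau> \<le> int m"
    proof cases
      case 1
      then show ?thesis using face_dim_le_complex_dim[OF X(1)] X(2) by simp
    next
      case 2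
      then obtain \<rho> where \<rho>: "\<rho> \<in> X" "card \<rho> = m" "\<gamma> \<subseteq> \<rho>"
        by (auto simp: combinatorial_boundary_def free_ridges_def)
      then have "card \<gamma> \<le> m" using X(1) card_mono unfolding complex_def by metis
      then show ?thesis using 2(1) card_insert_le_m1[of "Suc m" \<gamma> x] by (simp add: face_dim_def)
    qed
  qed
qed

text \<open>This is \<open>boundary_X\<close> for attaching the simplex to the empty family, with
  \<open>a = A\<close> and \<open>b = {}\<close>.\<close>

lemma combinatorial_boundary_simplex:
  assumes "finite A" "card A = Suc m"
  shows "combinatorial_boundary m (Pow A) = {\<gamma>. \<gamma> \<subset> A}"
proof -
  interpret attachment m A "{}" "{}" "Pow A" using attachment_simplex assms .
  have "facets (Pow A) = {A}" using facets_X by (simp add: facets_def)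
  then have "star_facets (Pow A) \<rho> \<subseteq> {A}" for \<rho> by (auto simp: star_facets_def)
  then have "card (star_facets (Pow A) \<rho>) \<le> 1" for \<rho>
    using card_mono[of "{A}" "star_facets (Pow A) \<rho>"] by simp
  then have "card (star_facets (Pow A) \<rho>) \<le> 2" for \<rho>
    using order_trans one_le_numeral by metis
  from boundary_X[OF fillable_empty star_connected_step[OF star_connected_empty] this]
  have "\<gamma> \<in> combinatorial_boundary m (Pow A) \<longleftrightarrow> (if \<gamma> \<subseteq> A then \<not> A \<subseteq> \<gamma> else \<gamma> \<in> combinatorial_boundary m {})"
    for \<gamma> by simp
  then show ?thesis by (auto simp: combinatorial_boundary_def free_ridges_def split: if_splits)
qed

text \<open>The apex is chosen outside the final complex, hence outside all earlier ones. Filling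
  and connectivity are carried along for every \<open>e\<close>, because each move needs them at its
  own \<alpha>. The move has the same \<beta>, so its index stays below \<open>k\<close>.\<close>

lemma shelling_to_bistellar:
  assumes steps: "(shelling_step (int m) k)\<^sup>*\<^sup>* (Pow A) X" and A: "finite A" "card A = Suc m" and "k \<le> m"
    and "weak_pseudomanifold (int m) X" "x \<notin> \<Union>X"
  shows "(\<forall>e. fillable m X e \<and> star_connected m X e) \<and> {} \<in> combinatorial_boundary m X \<and>
    (bistellar_step (int m) k)\<^sup>*\<^sup>* (simplex_boundary (insert x A)) (cone_off x X (combinatorial_boundary m X))"
  using steps assms(5,6)
proof (induction rule: rtranclp_induct)
  case base
  interpret attachment m A "{}" "{}" "Pow A" using attachment_simplex A .
  have "A \<noteq> {}" using A by auto
  have "x \<notin> A" using base by blast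
  \<comment> \<open>Coning off the boundary of the initial simplex gives the boundary of a simplex
    with one more vertex: the standard sphere.\<close>
  then have "simplex_boundary (insert x A) = cone_off x (Pow A) {\<gamma>. \<gamma> \<subset> A}"
    by (intro set_eqI, subst mem_cone_off) (auto simp: simplex_boundary_def)
  then show ?case
    using fillable_step[OF fillable_empty] star_connected_step[OF star_connected_empty] \<open>A \<noteq> {}\<close>
    by (auto simp: combinatorial_boundary_simplex[OF A])
next
  case (step Y X)
  then obtain \<alpha> \<beta> where move: "shelling_move (int m) \<alpha> \<beta> Y X" and k: "face_dim \<beta> < int k"
    by (auto simp: shelling_step_def)
  interpret attachment m \<alpha> \<beta> Y X using shelling_move_attachment[OF move] .
  have pX: "pure_complex (int m) X" and pY: "pure_complex (int m) Y" and sub: "Y \<subseteq> X" and "\<beta> \<noteq> {}"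
    using move by (auto simp: shelling_move_def)
  have cY: "complex Y" "complex_dim Y = int m" using pY by (auto simp: pure_complex_def)
  have weak: "card (star_facets X \<rho>) \<le> 2" if "\<rho> \<in> X" "card \<rho> = m" for \<rho>
    using step.prems(1) that by (auto simp: weak_pseudomanifold_def star_facets_def face_dim_def)
  \<comment> \<open>The ridge condition passes back from \<open>X\<close> to \<open>Y\<close>, since
    facets of \<open>Y\<close> stay facets of \<open>X\<close>.\<close>
  have "card (star_facets Y \<rho>) \<le> 2" if "\<rho> \<in> Y" "card \<rho> = m" for \<rho>
  proof -
    have "star_facets Y \<rho> \<subseteq> star_facets X \<rho>" using facets_X by (auto simp: star_facets_def)
    then show ?thesis
      using card_mono[OF finite_star_facets(1)] weak[of \<rho>] that sub by (meson order_trans subsetD)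
  qed
  then have "weak_pseudomanifold (int m) Y"
    using pY by (auto simp: weak_pseudomanifold_def star_facets_def face_dim_def)
  then have Y: "\<forall>e. fillable m Y e \<and> star_connected m Y e" "{} \<in> combinatorial_boundary m Y"
    and S: "(bistellar_step (int m) k)\<^sup>*\<^sup>* (simplex_boundary (insert x A)) (cone_off x Y (combinatorial_boundary m Y))"
    using step.IH step.prems(2) sub by blast+
  have X: "\<forall>e. fillable m X e \<and> star_connected m X e"
    using Y(1) fillable_step star_connected_step by blast
  \<comment> \<open>As the index is below \<open>k \<le> m\<close>, the new facet is larger than
    \<beta>. A nonempty \<alpha> also keeps \<open>{}\<close> in the boundary of
    \<open>X\<close>.\<close>
  have "card \<beta> < Suc m" using k \<open>k \<le> m\<close> by (simp add: face_dim_def)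
  then have "\<alpha> \<noteq> {}" using card_F by auto
  note thms = Y(1)[rule_format, THEN conjunct1] X[rule_format, THEN conjunct2] weak
  have "bistellar_move (int m) (insert x \<alpha>) \<beta>
      (cone_off x Y (combinatorial_boundary m Y)) (cone_off x X (combinatorial_boundary m X))"
    using bistellar_move_cone_off[OF thms \<open>\<alpha> \<noteq> {}\<close> \<open>\<beta> \<noteq> {}\<close> step.prems(2) cone_off_boundary_dim[OF cY Y(2)]] .
  then have "bistellar_step (int m) k
      (cone_off x Y (combinatorial_boundary m Y)) (cone_off x X (combinatorial_boundary m X))"
    using k unfolding bistellar_step_def by blast
  moreover have "{} \<in> combinatorial_boundary m X"
    using boundary_X[OF thms, of "{}"] \<open>\<alpha> \<noteq> {}\<close> by simp
  ultimately show ?case using X S by (blast intro: rtranclp.rtrancl_into_rtrancl)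
qed

lemma shelled_antistar:
  fixes B :: "'v::infinite set set"
  assumes "shelled d k B"
  shows "\<exists>S x. stellated_sphere d k S \<and> {x} \<in> S \<and> B = antistar x S"
proof -
  obtain A where k: "int k \<le> d" and w: "weak_pseudomanifold d B"
    and A: "finite A" "face_dim A = d" and steps: "(shelling_step d k)\<^sup>*\<^sup>* (Pow A) B"
    using assms by (auto simp: shelled_def pseudomanifold_def standard_ball_def)
  \<comment> \<open>The bound \<open>int k \<le> d\<close> makes \<open>d\<close> nonnegative, so
    this loses nothing.\<close>
  define m where "m = nat d"
  have d: "d = int m" using k by (simp add: m_def)
  have cA: "card A = Suc m" "k \<le> m" using A k d by (auto simp: face_dim_def)
  have B: "complex B" "complex_dim B = int m"
    using w d by (auto simp: weak_pseudomanifold_def pure_complex_def)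
  then have "finite (\<Union>B)" by (intro finite_vertices)
  then obtain x where x: "x \<notin> \<Union>B" using ex_new_if_finite infinite_UNIV by blast
  let ?S = "cone_off x B (combinatorial_boundary m B)"
  have e: "{} \<in> combinatorial_boundary m B"
    and S: "(bistellar_step d k)\<^sup>*\<^sup>* (simplex_boundary (insert x A)) ?S"
    using shelling_to_bistellar[OF steps[unfolded d] A(1) cA w[unfolded d] x] d by auto
  \<comment> \<open>Shelling moves only add faces, so the initial simplex survives and the new
    vertex avoids it.\<close>
  have "A \<in> B"
    using steps by (induction rule: rtranclp_induct) (auto simp: shelling_step_def shelling_move_def)
  then have "x \<notin> A" using x by blast
  then have "standard_sphere d (simplex_boundary (insert x A))"
    using A cA d unfolding standard_sphere_def
    by (intro exI[of _ "insert x A"]) (auto simp: face_dim_def)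
  then have "stellated_sphere d k ?S"
    using k S cone_off_boundary_dim[OF B e] d unfolding stellated_sphere_def by auto
  moreover have "{x} \<in> ?S" using e by (auto simp: cone_off_def)
  ultimately show ?thesis using antistar_cone_off[OF x] by metis
qed

theorem theorem2p8:
  fixes B :: "'v::infinite set set" and d :: int and k :: nat
  assumes "homology_ball TYPE('f::field) d B"
  shows "(stacked_ball TYPE('f) d k B \<longrightarrow>
            (\<exists>S x. stacked_sphere TYPE('f) d k S \<and> {x} \<in> S \<and> B = antistar x S)) \<and>
         (shelled d k B \<longrightarrow>
            (\<exists>S x. stellated_sphere d k S \<and> {x} \<in> S \<and> B = antistar x S))"
  using stacked_antistar shelled_antistar by blast

end
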